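(* Small cuts can be computed deterministically in $\mathrm{poly}(D)$ rounds. That is, for every constant $\lambda=O(1)$, there is a deterministic distributed algorithm in the CONGEST model that, on every unweighted graph $G$ of diameter $D$ with edge connectivity $\lambda$, computes a minimum (edge) cut of $G$ in $\mathrm{poly}(D)$ rounds.
   Context: CONGEST model: the graph $G$ is the communication network and its $n$ vertices are processors. Computation proceeds in synchronous rounds; in each round each vertex can send a message of $O(\log n)$ bits to each of its neighbors. The complexity measure is the number of rounds. The edge connectivity of a connected graph is the minimum number of edges whose removal disconnects it, and a minimum cut is a set of that many edges whose removal disconnects $G$. "Small" means of constant size. Output requirement: every vertex learns at least one minimum cut. Since $\lambda$ is a constant, the degree of the polynomial may depend on $\lambda$. *)

theory Defs
  imports Complex_Main "HOL-Computational_Algebra.Polynomial"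
begin

section \<open>Graphs, diameter and minimum cuts\<close>

definition simple_graph :: "nat set \<Rightarrow> nat set set \<Rightarrow> bool" where
  "simple_graph V E \<longleftrightarrow> finite V \<and> (\<forall>e\<in>E. e \<subseteq> V \<and> card e = 2)"

definition adj :: "nat set set \<Rightarrow> nat \<Rightarrow> nat \<Rightarrow> bool" where
  "adj E u v \<longleftrightarrow> {u, v} \<in> E"

definition neighbours :: "nat set set \<Rightarrow> nat \<Rightarrow> nat set" where
  "neighbours E v = {u. adj E v u}"

definition graph_connected :: "nat set \<Rightarrow> nat set set \<Rightarrow> bool" where
  "graph_connected V E \<longleftrightarrow> (\<forall>u\<in>V. \<forall>v\<in>V. (adj E)\<^sup>*\<^sup>* u v)"

definition graph_dist :: "nat set set \<Rightarrow> nat \<Rightarrow> nat \<Rightarrow> nat" where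
  "graph_dist E u v = (LEAST k. (adj E ^^ k) u v)"

definition diameter :: "nat set \<Rightarrow> nat set set \<Rightarrow> nat" where
  "diameter V E = Max {graph_dist E u v | u v. u \<in> V \<and> v \<in> V}"

definition edge_cut :: "nat set \<Rightarrow> nat set set \<Rightarrow> nat set set \<Rightarrow> bool" where
  "edge_cut V E C \<longleftrightarrow> C \<subseteq> E \<and> \<not> graph_connected V (E - C)"

text \<open>Meaningful only for graphs with at least two vertices: a one-vertex graph has no edge cut.\<close>

definition edge_connectivity :: "nat set \<Rightarrow> nat set set \<Rightarrow> nat" where
  "edge_connectivity V E = (LEAST k. \<exists>C. edge_cut V E C \<and> card C = k)"

definition minimum_cut :: "nat set \<Rightarrow> nat set set \<Rightarrow> nat set set \<Rightarrow> bool" where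
  "minimum_cut V E C \<longleftrightarrow> edge_cut V E C \<and> card C = edge_connectivity V E"

section \<open>The CONGEST model\<close>

text \<open>
  A vertex is named by its unique identifier. For a constant \<open>a\<close>, the identifiers in an
  \<open>n\<close>-vertex network are smaller than \<open>n ^ a\<close>, that is, they have \<open>O(log n)\<close> bits.
\<close>

definition network :: "nat \<Rightarrow> nat set \<Rightarrow> nat set set \<Rightarrow> bool" where
  "network a V E \<longleftrightarrow>
     simple_graph V E \<and> card V \<ge> 2 \<and> graph_connected V E \<and> V \<subseteq> {..<card V ^ a}"

type_synonym message = "bool list"

text \<open>The messages received by a vertex in one round, indexed by the sender.\<close>

type_synonym inbox = "nat \<Rightarrow> message"

text \<open>
  Initially a vertex knows its identifier and those of its neighbours, but neither the number of
  vertices nor the diameter. Its actions are functions of this and of the list of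
  all inboxes so far (oldest first). Local computation is unrestricted, so this is as general as a
  transition function on local states, and no type of states has to be fixed.
  \<open>decide\<close> yields \<open>None\<close> while the vertex is still running, and its final output when it halts.
\<close>

record 'out algorithm =
  send :: "nat \<Rightarrow> nat set \<Rightarrow> inbox list \<Rightarrow> nat \<Rightarrow> message"
  decide :: "nat \<Rightarrow> nat set \<Rightarrow> inbox list \<Rightarrow> 'out option"

definition halted :: "'out algorithm \<Rightarrow> nat \<Rightarrow> nat set \<Rightarrow> inbox list \<Rightarrow> bool" where
  "halted A v N h \<longleftrightarrow> (\<exists>s\<le>length h. decide A v N (take s h) \<noteq> None)"

text \<open>
  The message that \<open>u\<close> sends to \<open>v\<close> when \<open>h\<close> is what \<open>u\<close> has received so far. The empty message
  means silence; a halted vertex stays silent.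
\<close>

definition transmit ::
    "'out algorithm \<Rightarrow> nat set set \<Rightarrow> nat \<Rightarrow> inbox list \<Rightarrow> nat \<Rightarrow> message" where
  "transmit A E u h v =
     (if adj E u v \<and> \<not> halted A u (neighbours E u) h
      then send A u (neighbours E u) h v else [])"

text \<open>What \<open>v\<close> receives in the first \<open>t\<close> rounds of the execution.\<close>

primrec history :: "'out algorithm \<Rightarrow> nat set set \<Rightarrow> nat \<Rightarrow> nat \<Rightarrow> inbox list" where
  "history A E 0 = (\<lambda>v. [])"
| "history A E (Suc t) =
     (\<lambda>v. history A E t v @ [\<lambda>u. transmit A E u (history A E t u) v])"

text \<open>
  Messages have \<open>O(log n)\<close> bits, where the constant may depend on the algorithm and on the
  constant \<open>a\<close> bounding the identifiers, but not on the network.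
\<close>

definition congest :: "nat \<Rightarrow> 'out algorithm \<Rightarrow> bool" where
  "congest a A \<longleftrightarrow> (\<exists>c::real. \<forall>V E. network a V E \<longrightarrow>
     (\<forall>t. \<forall>u\<in>V. \<forall>v\<in>V.
        real (length (transmit A E u (history A E t u) v)) \<le> c * log 2 (real (card V))))"

text \<open>
  Only the first value decided counts. Since \<open>v\<close> itself must decide, it detects termination
  without being told the bound \<open>T\<close>.
\<close>

definition outputs_within ::
    "nat \<Rightarrow> 'out algorithm \<Rightarrow> nat set set \<Rightarrow> nat \<Rightarrow> 'out \<Rightarrow> bool" where
  "outputs_within T A E v x \<longleftrightarrow> (\<exists>t\<le>T.
     decide A v (neighbours E v) (history A E t v) = Some x \<and>
     (\<forall>s<t. decide A v (neighbours E v) (history A E s v) = None))"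

end

theory Submission
  imports Defs "HOL-Library.FuncSet" "HOL-Library.Log_Nat"
begin

text \<open>
  Let \<open>r\<close> be an elected vertex within distance \<open>d\<close> of all others. If a set \<open>F\<close> of \<open>k\<close> edges does not
  separate \<open>r\<close> from \<open>v\<close>, then some path of length \<open>O(k * d)\<close> from \<open>r\<close> to \<open>v\<close> avoids \<open>F\<close>. A counting
  argument gives a family of \<open>poly(d) * log n\<close> edge sets such that, for all disjoint \<open>F\<close> and \<open>P\<close> with
  at most \<open>k\<close> and \<open>O(k * d)\<close> edges, some member contains \<open>P\<close> and misses \<open>F\<close>. So a vertex \<open>v\<close> that knows
  in which members of the family it is reached from \<open>r\<close> by a short path knows all sets of \<open>k\<close> edges
  that separate it from \<open>r\<close>: those for which no member missing them reaches \<open>v\<close>. Reachability in one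
  member costs one bit per edge and round, so \<open>log n\<close> members are flooded at the same time, and no
  factor \<open>log n\<close> is left in the number of rounds.
\<close>

section \<open>Distances in graphs\<close>

primrec reaches :: "nat set set \<Rightarrow> nat \<Rightarrow> nat \<Rightarrow> nat \<Rightarrow> bool" where
  "reaches E 0 u v \<longleftrightarrow> u = v"
| "reaches E (Suc n) u v \<longleftrightarrow> reaches E n u v \<or> (\<exists>w. reaches E n u w \<and> adj E w v)"

lemma adj_sym: "adj E u v \<longleftrightarrow> adj E v u"
  by (simp add: adj_def insert_commute)

lemma mem_neighbours [simp]: "u \<in> neighbours E v \<longleftrightarrow> adj E u v"
  by (simp add: neighbours_def adj_sym)

lemma reaches_mono: "reaches E m u v \<Longrightarrow> m \<le> n \<Longrightarrow> reaches E n u v"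
proof (induction n)
  case (Suc n)
  then show ?case by (cases "m = Suc n") auto
qed simp

lemma reaches_mono_edges: "reaches E n u v \<Longrightarrow> E \<subseteq> E' \<Longrightarrow> reaches E' n u v"
  by (induction n arbitrary: v) (auto simp: adj_def)

lemma reaches_refl: "reaches E n u u"
  using reaches_mono[of E 0 u u n] by simp

lemma reaches_trans: "reaches E m u v \<Longrightarrow> reaches E n v w \<Longrightarrow> reaches E (m + n) u w"
  by (induction n arbitrary: w) auto

lemma reaches_sym: "reaches E n u v \<Longrightarrow> reaches E n v u"
proof (induction n arbitrary: v)
  case (Suc n)
  show ?case
  proof (cases "reaches E n u v")
    case True
    then show ?thesis using Suc.IH by simp
  next
    case False
    then obtain w where w: "reaches E n u w" "adj E w v"
      using Suc.prems by auto
    have "reaches E 1 v w" using w(2) by (simp add: adj_sym)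
    from reaches_trans[OF this Suc.IH[OF w(1)]] show ?thesis by simp
  qed
qed simp

lemma reaches_imp_rtranclp: "reaches E n u v \<Longrightarrow> (adj E)\<^sup>*\<^sup>* u v"
  by (induction n arbitrary: v) (auto intro: rtranclp.rtrancl_into_rtrancl)

lemma relpowp_imp_reaches: "(adj E ^^ n) u v \<Longrightarrow> reaches E n u v"
  by (induction n arbitrary: v) auto

lemma rtranclp_adj_sym: "(adj E)\<^sup>*\<^sup>* u v \<Longrightarrow> (adj E)\<^sup>*\<^sup>* v u"
  by (metis rtranclp_imp_relpowp relpowp_imp_reaches reaches_sym reaches_imp_rtranclp)

text \<open>A ball that gains nothing in one step is closed under adjacency, so it contains the
  whole component.\<close>

lemma reaches_stable:
  assumes "(adj E)\<^sup>*\<^sup>* u v" and "\<And>w. reaches E (Suc n) u w \<Longrightarrow> reaches E n u w"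
  shows "reaches E n u v"
  using assms(1)
proof induction
  case base
  show ?case by (rule reaches_refl)
next
  case (step w v)
  then have "reaches E (Suc n) u v" by auto
  then show ?case by (rule assms(2))
qed

lemma reaches_vertex:
  assumes "simple_graph V E" "reaches E n u v" "u \<in> V"
  shows "v \<in> V"
  using assms(2)
proof (induction n arbitrary: v)
  case (Suc n)
  then show ?case using assms(1) by (fastforce simp: simple_graph_def adj_def)
qed (use assms in simp)

lemma finite_neighbours:
  assumes "simple_graph V E"
  shows "finite (neighbours E v)"
proof (rule finite_subset)
  show "neighbours E v \<subseteq> V"
    using assms by (fastforce simp: simple_graph_def adj_def)
  show "finite V" using assms by (simp add: simple_graph_def)
qed

lemma reaches_path:
  assumes "reaches E n u v"
  obtains P where "P \<subseteq> E" "finite P" "card P \<le> n" "reaches P n u v"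
  using assms
proof (induction n arbitrary: v thesis)
  case 0
  then show ?case by (metis card.empty empty_subsetI finite.emptyI le_refl reaches.simps(1))
next
  case (Suc n)
  show ?case
  proof (cases "reaches E n u v")
    case True
    obtain P where "P \<subseteq> E" "finite P" "card P \<le> n" "reaches P n u v"
      using Suc.IH[OF _ True] by blast
    then show ?thesis by (intro Suc.prems(1)[of P]) auto
  next
    case False
    then obtain w where w: "reaches E n u w" "adj E w v"
      using Suc.prems by auto
    obtain P where P: "P \<subseteq> E" "finite P" "card P \<le> n" "reaches P n u w"
      using Suc.IH[OF _ w(1)] by blast
    have "reaches (insert {w, v} P) n u w"
      using P(4) by (rule reaches_mono_edges) auto
    then have "reaches (insert {w, v} P) (Suc n) u v"
      by (auto simp: adj_def)
    moreover have "card (insert {w, v} P) \<le> Suc n"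
      using P by (simp add: card_insert_if)
    ultimately show ?thesis
      using P w(2) by (intro Suc.prems(1)[of "insert {w, v} P"]) (auto simp: adj_def)
  qed
qed

lemma reaches_diameter:
  assumes "network a V E" "u \<in> V" "v \<in> V"
  shows "reaches E (diameter V E) u v"
proof -
  have fin: "finite V" and "(adj E)\<^sup>*\<^sup>* u v"
    using assms by (auto simp: network_def simple_graph_def graph_connected_def)
  then obtain n where "(adj E ^^ n) u v"
    by (meson rtranclp_imp_relpowp)
  then have "reaches E (graph_dist E u v) u v"
    unfolding graph_dist_def by (intro relpowp_imp_reaches) (rule LeastI)
  moreover have "graph_dist E u v \<le> diameter V E"
    unfolding diameter_def
  proof (rule Max_ge)
    have "{graph_dist E u v |u v. u \<in> V \<and> v \<in> V} = (\<lambda>(u, v). graph_dist E u v) ` (V \<times> V)"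
      by auto
    then show "finite {graph_dist E u v |u v. u \<in> V \<and> v \<in> V}"
      using fin by simp
  qed (use assms in blast)
  ultimately show ?thesis by (rule reaches_mono)
qed

text \<open>
  Behind the last deleted edge of a short walk from \<open>r\<close>, the walk survives: so the balls around
  \<open>r\<close> and the endpoints of the deleted edges still cover the graph.
\<close>

lemma reaches_delete:
  assumes "reaches E d r v"
  shows "\<exists>y\<in>insert r (\<Union>F). reaches (E - F) d y v"
  using assms
proof (induction d arbitrary: v)
  case (Suc d)
  show ?case
  proof (cases "reaches E d r v")
    case True
    then show ?thesis using Suc.IH by fastforce
  next
    case False
    then obtain w where w: "reaches E d r w" "adj E w v"
      using Suc.prems by auto
    show ?thesis
    proof (cases "{w, v} \<in> F")
      case True
      then have "v \<in> \<Union>F" by auto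
      then show ?thesis using reaches_refl by blast
    next
      case False
      then have "adj (E - F) w v" using w(2) by (simp add: adj_def)
      then show ?thesis using Suc.IH[OF w(1)] by auto
    qed
  qed
qed simp

text \<open>
  While the ball around \<open>u\<close> keeps growing, every \<open>2 * d + 1\<close> steps it meets the ball of a new
  centre.
\<close>

lemma reaches_of_cover:
  assumes "finite Y" and cover: "\<And>v. (adj E)\<^sup>*\<^sup>* u v \<Longrightarrow> \<exists>y\<in>Y. reaches E d y v"
    and conn: "(adj E)\<^sup>*\<^sup>* u v"
  shows "reaches E (card Y * (2 * d + 1)) u v"
proof -
  define C where "C n = {y\<in>Y. \<exists>w. reaches E n u w \<and> reaches E d y w}" for n
  have C_mono: "C m \<subseteq> C n" if "m \<le> n" for m n
    using reaches_mono[OF _ that] by (auto simp: C_def)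
  have "(\<exists>n\<le>i * (2 * d + 1). \<forall>w. reaches E (Suc n) u w \<longrightarrow> reaches E n u w)
      \<or> Suc i \<le> card (C (i * (2 * d + 1)))" for i
  proof (induction i)
    case 0
    obtain y where "y \<in> Y" "reaches E d y u"
      using cover[of u] by auto
    then have "C 0 \<noteq> {}" by (auto simp: C_def)
    moreover have "finite (C 0)" using \<open>finite Y\<close> by (simp add: C_def)
    ultimately show ?case by (simp add: Suc_le_eq card_gt_0_iff)
  next
    case (Suc i)
    let ?m = "i * (2 * d + 1)"
    show ?case
    proof (cases "C (?m + (2 * d + 1)) = C ?m")
      case True
      \<comment> \<open>No new centre was met, so the centre covering \<open>w\<close> already meets
        the \<open>?m\<close>-ball; the detour through it costs \<open>d + d\<close>.\<close>
      have "reaches E (?m + 2 * d) u w" if w: "reaches E (Suc (?m + 2 * d)) u w" for w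
      proof -
        obtain y where y: "y \<in> Y" "reaches E d y w"
          using cover reaches_imp_rtranclp[OF w] by blast
        then have "y \<in> C (?m + (2 * d + 1))"
          using w by (auto simp: C_def)
        then obtain x where x: "reaches E ?m u x" "reaches E d y x"
          unfolding True by (auto simp: C_def)
        have "reaches E (d + d) x w"
          using reaches_trans[OF reaches_sym[OF x(2)] y(2)] .
        from reaches_trans[OF x(1) this] show ?thesis by (simp add: mult_2)
      qed
      then show ?thesis by (intro disjI1 exI[of _ "?m + 2 * d"]) auto
    next
      case False
      then have "C ?m \<subset> C (?m + (2 * d + 1))"
        using C_mono[of ?m "?m + (2 * d + 1)"] by auto
      then have less: "card (C ?m) < card (C (?m + (2 * d + 1)))"
        using \<open>finite Y\<close> by (intro psubset_card_mono) (auto simp: C_def)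
      have eq: "?m + (2 * d + 1) = Suc i * (2 * d + 1)" by simp
      from Suc.IH show ?thesis
      proof
        assume "\<exists>n\<le>?m. \<forall>w. reaches E (Suc n) u w \<longrightarrow> reaches E n u w"
        moreover have "n \<le> Suc i * (2 * d + 1)" if "n \<le> ?m" for n
          using that by simp
        ultimately show ?thesis by blast
      next
        assume "Suc i \<le> card (C ?m)"
        then have "Suc (Suc i) \<le> card (C (Suc i * (2 * d + 1)))"
          using less unfolding eq by linarith
        then show ?thesis ..
      qed
    qed
  qed
  \<comment> \<open>For \<open>i = card Y\<close> this excludes the second alternative, so the ball
    has stopped growing by then.\<close>
  moreover have "card (C n) \<le> card Y" for n
    using \<open>finite Y\<close> by (intro card_mono) (auto simp: C_def)
  ultimately obtain n where n: "n \<le> card Y * (2 * d + 1)"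
    "\<forall>w. reaches E (Suc n) u w \<longrightarrow> reaches E n u w"
    using not_less_eq_eq by blast
  have "reaches E n u v"
    using conn by (rule reaches_stable) (use n(2) in blast)
  then show ?thesis using n(1) by (rule reaches_mono)
qed

text \<open>The centres are \<open>r\<close> and the at most \<open>2 * k\<close> endpoints of
  \<open>F\<close>; by \<open>reaches_delete\<close> their \<open>d\<close>-balls in the remaining
  graph cover it.\<close>

lemma reaches_after_deletion:
  assumes "simple_graph V E" "r \<in> V" and ecc: "\<And>v. v \<in> V \<Longrightarrow> reaches E d r v"
    and "finite F" "card F \<le> k" "\<And>e. e \<in> F \<Longrightarrow> card e = 2"
    and conn: "(adj (E - F))\<^sup>*\<^sup>* r v"
  shows "reaches (E - F) ((2 * k + 1) * (2 * d + 1)) r v"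
proof -
  let ?Y = "insert r (\<Union>F)"
  have "finite (\<Union>F)"
    using assms(4,6) by (metis card.infinite finite_Union zero_neq_numeral)
  have "card (\<Union>F) \<le> (\<Sum>e\<in>F. card e)"
    using card_Union_le_sum_card by blast
  also have "\<dots> = 2 * card F" using assms(6) by simp
  finally have "card ?Y \<le> 2 * k + 1"
    using \<open>finite (\<Union>F)\<close> assms(5) by (simp add: card_insert_if)
  moreover have "reaches (E - F) (card ?Y * (2 * d + 1)) r v"
  proof (rule reaches_of_cover)
    fix w assume "(adj (E - F))\<^sup>*\<^sup>* r w"
    then obtain n where "reaches (E - F) n r w"
      by (meson relpowp_imp_reaches rtranclp_imp_relpowp)
    then have "w \<in> V"
      using reaches_vertex[OF assms(1)] reaches_mono_edges assms(2) by (metis Diff_subset)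
    then show "\<exists>y\<in>?Y. reaches (E - F) d y w"
      using reaches_delete ecc by blast
  qed (use \<open>finite (\<Union>F)\<close> conn in auto)
  ultimately show ?thesis
    by (meson mult_le_mono1 reaches_mono)
qed

section \<open>Covering families\<close>

text \<open>Bernoulli's inequality for \<open>(1 - 1 / (2 * L)) ^ p\<close>, with denominators
  cleared.\<close>

lemma half_power_le:
  assumes "p \<le> L"
  shows "(2 * L) ^ p \<le> 2 * (2 * L - 1) ^ p" (is "?l \<le> ?r")
proof (cases "L = 0")
  case False
  define x where "x = 1 / (2 * real L)"
  have "real p * x \<le> 1 / 2"
    using assms False by (simp add: x_def field_simps)
  moreover have "1 + real p * (- x) \<le> (1 + (- x)) ^ p"
    using False by (intro Bernoulli_inequality) (simp add: x_def field_simps)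
  ultimately have "1 \<le> 2 * (1 - x) ^ p" by simp
  then have "real (2 * L) ^ p * 1 \<le> real (2 * L) ^ p * (2 * (1 - x) ^ p)"
    by (intro mult_left_mono) auto
  also have "\<dots> = 2 * (real (2 * L) * (1 - x)) ^ p"
    by (simp add: power_mult_distrib)
  also have "real (2 * L) * (1 - x) = real (2 * L - 1)"
    using False by (simp add: x_def field_simps of_nat_diff)
  finally have "real ?l \<le> real ?r" by simp
  then show ?thesis by (simp only: of_nat_le_iff)
qed (use assms in simp)

text \<open>
  A random colouring with \<open>2 * L\<close> colours gives every element of \<open>F\<close> the colour \<open>0\<close> with
  probability \<open>1 / (2 * L) ^ card F\<close>, and, independently, avoids the colour \<open>0\<close> on \<open>P\<close> with
  probability at least \<open>1 / 2\<close>.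
\<close>

lemma card_separating_colourings:
  assumes "finite U" "F \<subseteq> U" "P \<subseteq> U" "F \<inter> P = {}" "card F \<le> k" "card P \<le> L" "L \<ge> 1"
  shows "(2 * L) ^ card U
    \<le> 2 * (2 * L) ^ k * card {c \<in> U \<rightarrow>\<^sub>E {..<2 * L}. (\<forall>e\<in>F. c e = 0) \<and> (\<forall>e\<in>P. c e \<noteq> 0)}"
proof -
  let ?R = "U - F - P"
  \<comment> \<open>With \<open>T e\<close> as the colours allowed at \<open>e\<close>, the good
    colourings form a product and are counted factor by factor.\<close>
  define T where "T e = (if e \<in> F then {0} else if e \<in> P then {1..<2 * L} else {..<2 * L})" for e
  have fin: "finite F" "finite P" "finite ?R"
    using assms finite_subset by auto
  have U: "U = F \<union> (P \<union> ?R)" "F \<inter> (P \<union> ?R) = {}" "P \<inter> ?R = {}"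
    using assms by auto
  have split: "prod g U = prod g F * (prod g P * prod g ?R)" for g :: "_ \<Rightarrow> nat"
    using fin U by (metis finite_UnI prod.union_disjoint)
  have eq: "{c \<in> U \<rightarrow>\<^sub>E {..<2 * L}. (\<forall>e\<in>F. c e = 0) \<and> (\<forall>e\<in>P. c e \<noteq> 0)} = Pi\<^sub>E U T"
  proof (intro set_eqI iffI)
    fix c assume "c \<in> {c \<in> U \<rightarrow>\<^sub>E {..<2 * L}. (\<forall>e\<in>F. c e = 0) \<and> (\<forall>e\<in>P. c e \<noteq> 0)}"
    then show "c \<in> Pi\<^sub>E U T"
      by (auto simp: T_def PiE_iff Suc_le_eq)
  next
    fix c assume c: "c \<in> Pi\<^sub>E U T"
    have "c e < 2 * L" if "e \<in> U" for e
      using PiE_mem[OF c that] assms by (auto simp: T_def split: if_splits)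
    moreover have "c e = 0" if "e \<in> F" for e
      using PiE_mem[OF c, of e] that assms by (auto simp: T_def)
    moreover have "c e \<noteq> 0" if "e \<in> P" for e
    proof -
      have "e \<in> U" "T e = {1..<2 * L}" using that assms(3,4) by (auto simp: T_def)
      then show ?thesis using PiE_mem[OF c, of e] by simp
    qed
    ultimately show "c \<in> {c \<in> U \<rightarrow>\<^sub>E {..<2 * L}. (\<forall>e\<in>F. c e = 0) \<and> (\<forall>e\<in>P. c e \<noteq> 0)}"
      using c by (auto simp: PiE_iff)
  qed
  have "(\<Prod>e\<in>F. card (T e)) = 1" by (simp add: T_def)
  moreover have "(\<Prod>e\<in>P. card (T e)) = (\<Prod>e\<in>P. 2 * L - 1)"
    using assms(4) by (intro prod.cong) (auto simp: T_def)
  moreover have "(\<Prod>e\<in>?R. card (T e)) = (\<Prod>e\<in>?R. 2 * L)"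
    by (intro prod.cong) (auto simp: T_def)
  ultimately have card: "card (Pi\<^sub>E U T) = (2 * L - 1) ^ card P * (2 * L) ^ card ?R"
    by (simp add: card_PiE[OF assms(1)] split)
  have "(2 * L) ^ card U = (2 * L) ^ card F * ((2 * L) ^ card P * (2 * L) ^ card ?R)"
    using split[of "\<lambda>_. 2 * L"] by simp
  also have "\<dots> \<le> (2 * L) ^ k * (2 * (2 * L - 1) ^ card P * (2 * L) ^ card ?R)"
    using assms(5-7) half_power_le by (intro mult_mono power_increasing) auto
  also have "\<dots> = 2 * (2 * L) ^ k * card (Pi\<^sub>E U T)"
    by (simp add: card)
  finally show ?thesis unfolding eq .
qed

text \<open>Double counting of the pairs \<open>(c, x)\<close> with \<open>G c x\<close>: a share of
  \<open>1 / K\<close> for every \<open>x\<close> forces that share on average, hence for some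
  \<open>c\<close>.\<close>

lemma exists_average:
  fixes K :: nat
  assumes "finite \<Omega>" "\<Omega> \<noteq> {}" "finite X" "K \<ge> 1"
    and "\<And>x. x \<in> X \<Longrightarrow> card \<Omega> \<le> K * card {c \<in> \<Omega>. G c x}"
  shows "\<exists>c\<in>\<Omega>. card X \<le> K * card {x \<in> X. G c x}"
proof (rule ccontr)
  assume "\<not> ?thesis"
  then have "(\<Sum>c\<in>\<Omega>. K * card {x \<in> X. G c x}) < (\<Sum>c\<in>\<Omega>. card X)"
    using assms by (intro sum_strict_mono) auto
  also have "\<dots> = (\<Sum>x\<in>X. card \<Omega>)" by simp
  also have "\<dots> \<le> (\<Sum>x\<in>X. K * card {c \<in> \<Omega>. G c x})"
    using assms(5) by (rule sum_mono)
  also have "\<dots> = K * (\<Sum>x\<in>X. card {c \<in> \<Omega>. G c x})"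
    by (simp add: sum_distrib_left)
  also have "(\<Sum>x\<in>X. card {c \<in> \<Omega>. G c x}) = (\<Sum>c\<in>\<Omega>. card {x \<in> X. G c x})"
  proof -
    have "(\<Sum>x\<in>X. card {c \<in> \<Omega>. G c x}) = (\<Sum>x\<in>X. \<Sum>c\<in>\<Omega>. if G c x then 1 else 0)"
      using assms(1,3) by (intro sum.cong refl) (simp add: sum.If_cases Int_def)
    also have "\<dots> = (\<Sum>c\<in>\<Omega>. \<Sum>x\<in>X. if G c x then 1 else 0)"
      by (rule sum.swap)
    also have "\<dots> = (\<Sum>c\<in>\<Omega>. card {x \<in> X. G c x})"
      using assms(1,3) by (intro sum.cong refl) (simp add: sum.If_cases Int_def)
    finally show ?thesis .
  qed
  finally show False by (simp add: sum_distrib_left)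
qed

text \<open>Each new set is chosen for the elements still missed and hits a \<open>1 / K\<close>
  share of them, so every choice gains a factor \<open>1 - 1 / K\<close>. Denominators are cleared
  to stay in \<open>nat\<close>.\<close>

lemma greedy_cover:
  fixes K :: nat
  assumes "finite X" "K \<ge> 1"
    and step: "\<And>Y. Y \<subseteq> X \<Longrightarrow> \<exists>S. card Y \<le> K * card {x \<in> Y. G S x}"
  shows "\<exists>f. K ^ n * card {x \<in> X. \<forall>i<n. \<not> G (f i) x} \<le> (K - 1) ^ n * card X"
proof (induction n)
  case (Suc n)
  then obtain f where f: "K ^ n * card {x \<in> X. \<forall>i<n. \<not> G (f i) x} \<le> (K - 1) ^ n * card X"
    by blast
  let ?Y = "{x \<in> X. \<forall>i<n. \<not> G (f i) x}"
  obtain S where S: "card ?Y \<le> K * card {x \<in> ?Y. G S x}"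
    using step[of ?Y] by auto
  let ?f = "f(n := S)"
  have Y': "{x \<in> X. \<forall>i<Suc n. \<not> G (?f i) x} = ?Y - {x \<in> ?Y. G S x}"
    by (auto simp: less_Suc_eq)
  have "card {x \<in> X. \<forall>i<Suc n. \<not> G (?f i) x} = card ?Y - card {x \<in> ?Y. G S x}"
    unfolding Y' using assms(1) by (intro card_Diff_subset) auto
  then have "K * card {x \<in> X. \<forall>i<Suc n. \<not> G (?f i) x} \<le> (K - 1) * card ?Y"
    using S by (simp add: diff_mult_distrib diff_mult_distrib2)
  then have "K ^ n * (K * card {x \<in> X. \<forall>i<Suc n. \<not> G (?f i) x}) \<le> K ^ n * ((K - 1) * card ?Y)"
    by (rule mult_le_mono2)
  also have "\<dots> = (K - 1) * (K ^ n * card ?Y)" by (rule mult.left_commute)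
  also have "\<dots> \<le> (K - 1) * ((K - 1) ^ n * card X)"
    using f by (rule mult_le_mono2)
  finally show ?case
    by (intro exI[of _ ?f]) (simp only: power_Suc mult_ac)
qed simp

text \<open>A small subset is listed as a word of length \<open>n\<close>, padded with
  \<open>None\<close>, over \<open>card U + 1\<close> letters.\<close>

lemma card_bounded_subsets:
  assumes "finite U"
  shows "card {P. P \<subseteq> U \<and> card P \<le> n} \<le> Suc (card U) ^ n"
proof -
  let ?A = "insert None (Some ` U)"
  let ?Ls = "{xs. set xs \<subseteq> ?A \<and> length xs = n}"
  have "{P. P \<subseteq> U \<and> card P \<le> n} \<subseteq> (\<lambda>xs. {x. Some x \<in> set xs}) ` ?Ls"
  proof
    fix P assume "P \<in> {P. P \<subseteq> U \<and> card P \<le> n}"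
    then have P: "P \<subseteq> U" "card P \<le> n" by auto
    then obtain ys where ys: "set ys = P" "length ys = card P"
      using assms by (metis finite_distinct_list distinct_card finite_subset)
    let ?xs = "map Some ys @ replicate (n - length ys) None"
    have "?xs \<in> ?Ls" "P = {x. Some x \<in> set ?xs}" using P ys by auto
    then show "P \<in> (\<lambda>xs. {x. Some x \<in> set xs}) ` ?Ls" by blast
  qed
  then have "card {P. P \<subseteq> U \<and> card P \<le> n} \<le> card ?Ls"
    using assms by (intro surj_card_le finite_lists_length_eq) auto
  also have "\<dots> = Suc (card U) ^ n"
    using assms by (subst card_lists_length_eq) (auto simp: card_image)
  finally show ?thesis .
qed

text \<open>Dual to cover-free families: sending an element to the set of members containing it
  gives one with parameters \<open>L\<close> and \<open>k\<close>.\<close>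

definition covers :: "'a set set \<Rightarrow> 'a set \<Rightarrow> nat \<Rightarrow> nat \<Rightarrow> bool" where
  "covers \<S> U k L \<longleftrightarrow> (\<forall>F P. F \<subseteq> U \<and> P \<subseteq> U \<and> F \<inter> P = {} \<and> card F \<le> k \<and> card P \<le> L
     \<longrightarrow> (\<exists>S\<in>\<S>. F \<inter> S = {} \<and> P \<subseteq> S))"

text \<open>By averaging over colourings, some set is good for a \<open>1 / K\<close> share of any
  set of pairs \<open>(F, P)\<close>. There are at most \<open>4 ^ (b * (k + L))\<close> pairs, and
  the greedy choice exhausts them.\<close>

lemma exists_covering_family:
  fixes U :: "'a set" and b k L :: nat
  defines "K \<equiv> 2 * (2 * L) ^ k"
  assumes "finite U" "card U < 4 ^ b" "b \<ge> 1" "L \<ge> 1"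
  shows "\<exists>f. covers (f ` {..<3 * K * (k + L) * b}) U k L"
proof -
  let ?n = "3 * K * (k + L) * b"
  define X where "X = {(F, P). F \<subseteq> U \<and> P \<subseteq> U \<and> F \<inter> P = {} \<and> card F \<le> k \<and> card P \<le> L}"
  define G where "G S x \<longleftrightarrow> fst x \<inter> S = {} \<and> snd x \<subseteq> S" for S :: "'a set" and x
  have K: "K \<ge> 1" using \<open>L \<ge> 1\<close> by (simp add: K_def)
  have X_sub: "X \<subseteq> {F. F \<subseteq> U \<and> card F \<le> k} \<times> {P. P \<subseteq> U \<and> card P \<le> L}"
    by (auto simp: X_def)
  have fin: "finite ({F. F \<subseteq> U \<and> card F \<le> k} \<times> {P. P \<subseteq> U \<and> card P \<le> L})"
    using assms(2) by simp
  then have "finite X" using X_sub finite_subset by blast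
  have "card X \<le> card {F. F \<subseteq> U \<and> card F \<le> k} * card {P. P \<subseteq> U \<and> card P \<le> L}"
    using card_mono[OF fin X_sub] by (simp add: card_cartesian_product)
  also have "\<dots> \<le> Suc (card U) ^ k * Suc (card U) ^ L"
    by (intro mult_le_mono card_bounded_subsets assms(2))
  also have "\<dots> \<le> (4 ^ b) ^ k * (4 ^ b) ^ L"
    using assms(3) by (intro mult_le_mono power_mono) auto
  also have "\<dots> = 4 ^ (b * (k + L))"
    by (simp add: power_add power_mult distrib_left)
  finally have card_X: "card X \<le> 4 ^ (b * (k + L))" .
  have "\<exists>S. card Y \<le> K * card {x \<in> Y. G S x}" if Y: "Y \<subseteq> X" for Y
  proof -
    let ?\<Omega> = "U \<rightarrow>\<^sub>E {..<2 * L}"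
    have "\<exists>c\<in>?\<Omega>. card Y \<le> K * card {x \<in> Y. G {e\<in>U. c e \<noteq> 0} x}"
    proof (rule exists_average)
      show "finite ?\<Omega>" using assms(2) by (simp add: finite_PiE)
      show "?\<Omega> \<noteq> {}" using \<open>L \<ge> 1\<close> by (auto simp: PiE_eq_empty_iff lessThan_empty_iff)
      show "finite Y" using Y \<open>finite X\<close> finite_subset by blast
      fix x assume "x \<in> Y"
      then obtain F P where x: "x = (F, P)"
        and FP: "F \<subseteq> U" "P \<subseteq> U" "F \<inter> P = {}" "card F \<le> k" "card P \<le> L"
        using Y by (auto simp: X_def)
      have "{c \<in> ?\<Omega>. G {e\<in>U. c e \<noteq> 0} x}
          = {c \<in> ?\<Omega>. (\<forall>e\<in>F. c e = 0) \<and> (\<forall>e\<in>P. c e \<noteq> 0)}"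
        using FP by (auto simp: G_def x)
      then show "card ?\<Omega> \<le> K * card {c \<in> ?\<Omega>. G {e\<in>U. c e \<noteq> 0} x}"
        using card_separating_colourings[OF assms(2) FP \<open>L \<ge> 1\<close>] assms(2)
        by (simp add: K_def card_PiE)
    qed (use K in auto)
    then show ?thesis by blast
  qed
  from greedy_cover[OF \<open>finite X\<close> K this]
  obtain f where f: "K ^ ?n * card {x \<in> X. \<forall>i<?n. \<not> G (f i) x} \<le> (K - 1) ^ ?n * card X"
    by blast
  \<comment> \<open>With \<open>z = b * (k + L)\<close>, at most
    \<open>(1 - 1 / K) ^ (3 * K * z) * 4 ^ z\<close> pairs remain. This is at most
    \<open>exp (- 3 * z) * exp (2 * z)\<close>, which is below \<open>1\<close> since
    \<open>z > 0\<close>.\<close>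
  have "{x \<in> X. \<forall>i<?n. \<not> G (f i) x} = {}"
  proof (rule ccontr)
    assume "{x \<in> X. \<forall>i<?n. \<not> G (f i) x} \<noteq> {}"
    then have pos: "1 \<le> card {x \<in> X. \<forall>i<?n. \<not> G (f i) x}"
      using \<open>finite X\<close> by (simp add: Suc_le_eq card_gt_0_iff)
    let ?z = "b * (k + L)"
    have "K ^ ?n \<le> (K - 1) ^ ?n * card X"
      using order_trans[OF mult_le_mono2[OF pos] f] by (simp only: mult_1_right)
    also have "\<dots> \<le> (K - 1) ^ ?n * 4 ^ ?z"
      using card_X by simp
    finally have "real (K ^ ?n) \<le> real ((K - 1) ^ ?n * 4 ^ ?z)"
      by (simp only: of_nat_le_iff)
    then have le: "real K ^ ?n \<le> (real K - 1) ^ ?n * 4 ^ ?z"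
      using K by (simp add: of_nat_diff)
    have "real K - 1 \<le> real K * exp (- 1 / real K)"
      using exp_ge_add_one_self[of "- 1 / real K"] K
      by (simp add: field_simps)
    then have "(real K - 1) ^ ?n \<le> (real K * exp (- 1 / real K)) ^ ?n"
      using K by (intro power_mono) auto
    also have "\<dots> = real K ^ ?n * exp (- 3 * real ?z)"
      using K by (simp add: power_mult_distrib field_simps flip: exp_of_nat_mult)
    finally have "real K ^ ?n \<le> real K ^ ?n * exp (- 3 * real ?z) * 4 ^ ?z"
      using le by (meson mult_right_mono order_trans zero_le_numeral zero_le_power)
    then have "1 \<le> exp (- 3 * real ?z) * 4 ^ ?z"
      using K by (simp add: mult.assoc)
    also have "(4::real) ^ ?z \<le> exp 2 ^ ?z"
    proof (intro power_mono)
      have "(2::real) * 2 \<le> exp 1 * exp 1"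
        using exp_ge_add_one_self[of 1] by (intro mult_mono) auto
      then show "(4::real) \<le> exp 2" by (simp flip: exp_add)
    qed auto
    then have "exp (- 3 * real ?z) * 4 ^ ?z \<le> exp (- 3 * real ?z) * exp 2 ^ ?z"
      by (intro mult_left_mono) auto
    also have "\<dots> = exp (- real ?z)"
      by (simp flip: exp_of_nat_mult exp_add)
    finally have "real ?z \<le> 0" by simp
    then have "?z = 0" by (simp only: of_nat_le_0_iff)
    then show False using assms by simp
  qed
  then have hit: "\<exists>i<?n. G (f i) x" if "x \<in> X" for x
    using that by blast
  have "covers (f ` {..<?n}) U k L"
    unfolding covers_def
  proof (intro allI impI)
    fix F P assume "F \<subseteq> U \<and> P \<subseteq> U \<and> F \<inter> P = {} \<and> card F \<le> k \<and> card P \<le> L"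
    then obtain i where "i < ?n" "G (f i) (F, P)"
      using hit[of "(F, P)"] by (auto simp: X_def)
    then show "\<exists>S\<in>f ` {..<?n}. F \<inter> S = {} \<and> P \<subseteq> S"
      by (intro bexI[of _ "f i"]) (simp_all add: G_def)
  qed
  then show ?thesis by blast
qed

section \<open>The algorithm\<close>

definition bits :: "nat \<Rightarrow> nat" where
  "bits m = floorlog 2 m"

text \<open>The leading bit separates the identifier \<open>0\<close>, which has no bits, from
  \<open>None\<close>, which is sent as silence.\<close>

definition encode_id :: "nat option \<Rightarrow> message" where
  "encode_id x = (case x of None \<Rightarrow> [] | Some m \<Rightarrow> True # map (bit m) [0..<bits m])"

definition decode_id :: "message \<Rightarrow> nat option" where
  "decode_id l = (if l = [] then None else Some (horner_sum of_bool 2 (tl l)))"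

definition edges_upto :: "nat \<Rightarrow> nat set set" where
  "edges_upto b = {e. e \<subseteq> {..<2 ^ b} \<and> card e = 2}"

definition cuts_upto :: "nat \<Rightarrow> nat \<Rightarrow> nat set set set" where
  "cuts_upto k b = {F. F \<subseteq> edges_upto b \<and> card F = k}"

text \<open>There are fewer than \<open>4 ^ b\<close> possible edges, so \<open>2 * b * k\<close>
  bits suffice for \<open>k\<close> of them. The length is fixed for every \<open>F\<close>, so the
  message bound needs no validity of the cut.\<close>

definition cut_code :: "nat \<Rightarrow> nat \<Rightarrow> nat set set \<Rightarrow> message" where
  "cut_code k b = (SOME f. inj_on f (cuts_upto k b) \<and> (\<forall>F. length (f F) = 2 * b * k))"

definition encode_cut :: "nat \<Rightarrow> nat \<Rightarrow> nat set set option \<Rightarrow> message" where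
  "encode_cut k b w = (case w of None \<Rightarrow> [] | Some F \<Rightarrow> True # cut_code k b F)"

definition decode_cut :: "nat \<Rightarrow> nat \<Rightarrow> message \<Rightarrow> nat set set" where
  "decode_cut k b l = inv_into (cuts_upto k b) (cut_code k b) (tl l)"

text \<open>
  A path avoiding a cut of \<open>k\<close> edges need not be longer than \<open>radius k d\<close> when all vertices are
  within distance \<open>d\<close> of its source; \<open>chunks k d * b\<close> is the size of a covering family for such
  cuts and paths, one bit per member, sent in messages of \<open>b\<close> bits.
\<close>

definition radius :: "nat \<Rightarrow> nat \<Rightarrow> nat" where
  "radius k d = (2 * k + 1) * (2 * d + 1)"

definition chunks :: "nat \<Rightarrow> nat \<Rightarrow> nat" where
  "chunks k d = 3 * (2 * (2 * radius k d) ^ k) * (k + radius k d)"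

text \<open>The choice depends on \<open>k\<close>, \<open>d\<close> and \<open>b\<close> only, so
  all vertices use the same family without communication. The index \<open>j\<close> is the chunk,
  \<open>i\<close> the bit position in a message.\<close>

definition family :: "nat \<Rightarrow> nat \<Rightarrow> nat \<Rightarrow> nat \<Rightarrow> nat \<Rightarrow> nat set set" where
  "family k d b = (SOME f. covers {f j i | j i. j < chunks k d \<and> i < b} (edges_upto b) k (radius k d))"

definition candidates :: "nat \<Rightarrow> nat \<Rightarrow> nat \<Rightarrow> (nat \<Rightarrow> nat \<Rightarrow> bool) \<Rightarrow> nat set set set" where
  "candidates k d b R = {F \<in> cuts_upto k b.
     \<forall>j<chunks k d. \<forall>i<b. F \<inter> family k d b j i = {} \<longrightarrow> \<not> R j i}"

definition choose_candidate :: "nat \<Rightarrow> nat \<Rightarrow> nat \<Rightarrow> (nat \<Rightarrow> nat \<Rightarrow> bool) \<Rightarrow> nat set set option" where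
  "choose_candidate k d b R =
     (if candidates k d b R = {} then None else Some (SOME F. F \<in> candidates k d b R))"

text \<open>
  All vertices are always in the same stage. In \<open>Elect d j x\<close> they guess that every vertex is within
  distance \<open>d\<close> of the vertex of maximal identifier: \<open>x\<close> is the largest identifier seen, and becomes
  \<open>None\<close> once two neighbours are found to disagree. In \<open>Reach d M i R\<close>, the vertex \<open>M\<close> is elected and
  \<open>R\<close> tells in which members of the family the vertex is reached from \<open>M\<close>. In \<open>Spread d M i w\<close>,
  a cut \<open>w\<close> is broadcast.
\<close>

datatype state =
    Elect nat nat "nat option"
  | Reach nat nat nat "nat \<Rightarrow> nat \<Rightarrow> bool"
  | Spread nat nat nat "nat set set option"
  | Halt "nat set set"

text \<open>The first \<open>d\<close> rounds flood the maximum, all values being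
  \<open>Some\<close>. Later rounds only compare; a conflict spreads because a \<open>None\<close>
  next to a \<open>Some\<close> is again a conflict.\<close>

definition merge_id :: "nat \<Rightarrow> nat \<Rightarrow> nat option \<Rightarrow> nat option set \<Rightarrow> nat option" where
  "merge_id d j x X = (if j < d then Some (Max (the ` insert x X)) else if X \<subseteq> {x} then x else None)"

definition merge_cut :: "nat set \<Rightarrow> 'a option \<Rightarrow> (nat \<Rightarrow> 'a option) \<Rightarrow> 'a option" where
  "merge_cut N w W = (case w of Some F \<Rightarrow> Some F
     | None \<Rightarrow> if \<exists>u\<in>N. W u \<noteq> None then W (SOME u. u \<in> N \<and> W u \<noteq> None) else None)"

fun message :: "nat \<Rightarrow> state \<Rightarrow> nat \<Rightarrow> nat \<Rightarrow> message" where
  "message k (Elect d j x) v u = encode_id x"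
| "message k (Reach d M y R) v u =
     map (\<lambda>i. R (y div radius k d) i \<and> {v, u} \<in> family k d (bits M) (y div radius k d) i) [0..<bits M]"
| "message k (Spread d M z w) v u = encode_cut k (bits M) w"
| "message k (Halt C) v u = []"

text \<open>A phase with guess \<open>d\<close> floods for \<open>d\<close> rounds and checks for
  \<open>2 * d + 1\<close>. On a network, \<open>the w'\<close> can meet \<open>None\<close> only if
  the edge connectivity is not \<open>k\<close>.\<close>

fun step :: "nat \<Rightarrow> nat \<Rightarrow> nat set \<Rightarrow> state \<Rightarrow> inbox \<Rightarrow> state" where
  "step k v N (Elect d j x) I =
     (let x' = merge_id d j x ((\<lambda>u. decode_id (I u)) ` N) in
      if j = 3 * d then (case x' of None \<Rightarrow> Elect (Suc d) 0 (Some v) | Some M \<Rightarrow> Reach d M 0 (\<lambda>j i. v = M))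
      else Elect d (Suc j) x')"
| "step k v N (Reach d M y R) I =
     (let R' = (\<lambda>j i. R j i \<or> (j = y div radius k d \<and> i < bits M \<and> (\<exists>u\<in>N. I u ! i))) in
      if Suc y = chunks k d * radius k d then Spread d M 0 (choose_candidate k d (bits M) R')
      else Reach d M (Suc y) R')"
| "step k v N (Spread d M z w) I =
     (let w' = merge_cut N w (\<lambda>u. if I u = [] then None else Some (decode_cut k (bits M) (I u))) in
      if z = 2 * d then Halt (the w') else Spread d M (Suc z) w')"
| "step k v N (Halt C) I = Halt C"

definition local_state :: "nat \<Rightarrow> nat \<Rightarrow> nat set \<Rightarrow> inbox list \<Rightarrow> state" where
  "local_state k v N h = foldl (step k v N) (Elect 0 0 (Some v)) h"

fun result :: "state \<Rightarrow> nat set set option" where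
  "result (Halt C) = Some C"
| "result _ = None"

definition cut_algorithm :: "nat \<Rightarrow> nat set set algorithm" where
  "cut_algorithm k = \<lparr>send = (\<lambda>v N h u. message k (local_state k v N h) v u),
     decide = (\<lambda>v N h. result (local_state k v N h))\<rparr>"

section \<open>Executions in terms of states, and their agreement with the model\<close>

primrec run :: "nat \<Rightarrow> nat set set \<Rightarrow> nat \<Rightarrow> nat \<Rightarrow> state" where
  "run k E 0 v = Elect 0 0 (Some v)"
| "run k E (Suc t) v = step k v (neighbours E v) (run k E t v)
     (\<lambda>u. if adj E u v then message k (run k E t u) u v else [])"

lemma step_Halt: "foldl (step k v N) (Halt C) h = Halt C"
  by (induction h) auto

lemma result_eq_Some: "result s = Some C \<longleftrightarrow> s = Halt C"
  by (cases s) auto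

lemma decide_cut_algorithm: "decide (cut_algorithm k) v N h = result (local_state k v N h)"
  by (simp add: cut_algorithm_def)

lemma local_state_append_Halt:
  "local_state k v N h = Halt C \<Longrightarrow> local_state k v N (h @ h') = Halt C"
  by (simp add: local_state_def step_Halt)

text \<open>\<open>Halt\<close> is absorbing, so having halted at some time is visible in the
  current state.\<close>

lemma halted_iff:
  "halted (cut_algorithm k) v N h \<longleftrightarrow> (\<exists>C. local_state k v N h = Halt C)"
proof
  assume "halted (cut_algorithm k) v N h"
  then obtain s C where "local_state k v N (take s h) = Halt C"
    by (auto simp: halted_def cut_algorithm_def result_eq_Some)
  then show "\<exists>C. local_state k v N h = Halt C"
    using local_state_append_Halt[of k v N "take s h" C "drop s h"] by auto
next
  assume "\<exists>C. local_state k v N h = Halt C"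
  then show "halted (cut_algorithm k) v N h"
    unfolding halted_def by (intro exI[of _ "length h"]) (auto simp: cut_algorithm_def)
qed

text \<open>The test for halting disappears because the message of a \<open>Halt\<close> state is
  already empty.\<close>

lemma transmit_eq:
  "transmit (cut_algorithm k) E u h v =
     (if adj E u v then message k (local_state k u (neighbours E u) h) u v else [])"
  by (auto simp: transmit_def halted_iff) (auto simp: cut_algorithm_def)

lemma local_state_history:
  "local_state k v (neighbours E v) (history (cut_algorithm k) E t v) = run k E t v"
proof (induction t arbitrary: v)
  case (Suc t)
  have "local_state k v (neighbours E v) (h @ [I]) = step k v (neighbours E v) (local_state k v (neighbours E v) h) I" for h I
    by (simp add: local_state_def)
  then show ?case by (simp add: Suc transmit_eq cong: if_cong)
qed (simp add: local_state_def)

lemma run_Halt: "run k E t v = Halt C \<Longrightarrow> run k E (t + n) v = Halt C"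
  by (induction n) auto

lemma outputs_withinI:
  assumes "run k E T v = Halt C"
  shows "outputs_within T (cut_algorithm k) E v C"
proof -
  define t where "t = (LEAST t. \<exists>C. run k E t v = Halt C)"
  have "t \<le> T" unfolding t_def using assms by (blast intro: Least_le)
  obtain C' where C': "run k E t v = Halt C'"
    using LeastI_ex[of "\<lambda>t. \<exists>C. run k E t v = Halt C"] assms unfolding t_def by blast
  have "C' = C"
    using run_Halt[OF C', of "T - t"] \<open>t \<le> T\<close> assms by simp
  moreover have "result (run k E s v) = None" if "s < t" for s
    using not_less_Least[of s "\<lambda>t. \<exists>C. run k E t v = Halt C"] that
    unfolding t_def by (cases "run k E s v") auto
  ultimately show ?thesis
    using C' \<open>t \<le> T\<close> unfolding outputs_within_def
    by (intro exI[of _ t]) (simp add: decide_cut_algorithm local_state_history)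
qed

lemma congestI:
  assumes "\<And>V E t u v. network a V E \<Longrightarrow> u \<in> V \<Longrightarrow> v \<in> V \<Longrightarrow>
    real (length (message k (run k E t u) u v)) \<le> c * log 2 (real (card V))"
    and "c \<ge> 0"
  shows "congest a (cut_algorithm k)"
  unfolding congest_def
proof (intro exI[of _ c] allI impI ballI)
  fix V E t u v
  assume net: "network a V E" and "u \<in> V" "v \<in> V"
  \<comment> \<open>This settles pairs that are not adjacent, where nothing is sent.\<close>
  have "0 \<le> c * log 2 (real (card V))"
    using net \<open>c \<ge> 0\<close> by (simp add: network_def)
  then show "real (length (transmit (cut_algorithm k) E u (history (cut_algorithm k) E t u) v))
      \<le> c * log 2 (real (card V))"
    using assms(1)[OF net \<open>u \<in> V\<close> \<open>v \<in> V\<close>] by (simp add: transmit_eq local_state_history)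
qed

section \<open>Encodings\<close>

lemma less_two_power_bits: "m < 2 ^ bits m"
  using floorlog_bounds[of m 2] by (cases "m = 0") (auto simp: bits_def)

lemma decode_encode_id [simp]: "decode_id (encode_id x) = x"
proof (cases x)
  case (Some m)
  then show ?thesis
    using less_two_power_bits[of m]
    by (simp add: decode_id_def encode_id_def horner_sum_bit_eq_take_bit take_bit_nat_eq_self)
qed (simp add: decode_id_def encode_id_def)

lemma finite_edges_upto: "finite (edges_upto b)"
  unfolding edges_upto_def by (rule finite_subset[of _ "Pow {..<2 ^ b}"]) auto

lemma card_edges_upto: "card (edges_upto b) < 4 ^ b"
proof -
  have "card (edges_upto b) = 2 ^ b choose 2"
    using n_subsets[of "{..<2 ^ b :: nat}" 2] by (simp add: edges_upto_def)
  also have "\<dots> < 2 ^ b * 2 ^ b"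
    by (simp add: choose_two)
       (metis One_nat_def diff_Suc_less div_le_dividend mult_less_cancel1 order_le_less_trans pos2 zero_less_power)
  also have "\<dots> = 4 ^ b" by (simp flip: power_mult_distrib)
  finally show ?thesis .
qed

lemma finite_cuts_upto: "finite (cuts_upto k b)"
  unfolding cuts_upto_def by (rule finite_subset[of _ "Pow (edges_upto b)"]) (auto simp: finite_edges_upto)

lemma cut_code_spec: "inj_on (cut_code k b) (cuts_upto k b) \<and> (\<forall>F. length (cut_code k b F) = 2 * b * k)"
proof -
  let ?B = "{l. set l \<subseteq> (UNIV :: bool set) \<and> length l = 2 * b * k}"
  have "card (cuts_upto k b) = card (edges_upto b) choose k"
    using n_subsets[OF finite_edges_upto, of b k] by (simp add: cuts_upto_def)
  also have "\<dots> \<le> card (edges_upto b) ^ k"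
    by (cases "k \<le> card (edges_upto b)") (auto simp: binomial_le_pow binomial_eq_0)
  also have "\<dots> \<le> (4 ^ b) ^ k"
    using card_edges_upto[of b] by (intro power_mono) auto
  also have "\<dots> = 2 ^ (2 * b * k)"
    by (simp add: power_mult)
  also have "\<dots> = card ?B"
    by (subst card_lists_length_eq) auto
  finally have "card (cuts_upto k b) \<le> card ?B" .
  moreover have "finite ?B" by (rule finite_lists_length_eq) simp
  ultimately obtain f where f: "f ` cuts_upto k b \<subseteq> ?B" "inj_on f (cuts_upto k b)"
    using card_le_inj[OF finite_cuts_upto] by blast
  \<comment> \<open>The default outside \<open>cuts_upto k b\<close> gives every \<open>F\<close> a
    code of the right length.\<close>
  let ?f = "\<lambda>F. if F \<in> cuts_upto k b then f F else replicate (2 * b * k) True"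
  have "inj_on ?f (cuts_upto k b) \<and> (\<forall>F. length (?f F) = 2 * b * k)"
    using f by (auto simp: inj_on_def)
  then show ?thesis
    unfolding cut_code_def
    by (rule someI[of "\<lambda>f. inj_on f (cuts_upto k b) \<and> (\<forall>F. length (f F) = 2 * b * k)"])
qed

lemma decode_encode_cut:
  "F \<in> cuts_upto k b \<Longrightarrow> decode_cut k b (encode_cut k b (Some F)) = F"
  using cut_code_spec[of k b] by (simp add: decode_cut_def encode_cut_def)

lemma encode_cut_eq_Nil [simp]: "encode_cut k b w = [] \<longleftrightarrow> w = None"
  by (simp add: encode_cut_def split: option.split)

text \<open>The \<open>chunks k d * b\<close> members of the covering family are indexed by quotient
  and remainder modulo \<open>b\<close>.\<close>

lemma covers_family:
  assumes "b \<ge> 1"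
  shows "covers {family k d b j i | j i. j < chunks k d \<and> i < b} (edges_upto b) k (radius k d)"
proof -
  have "radius k d \<ge> 1" by (simp add: radius_def)
  from exists_covering_family[OF finite_edges_upto card_edges_upto assms this, of k]
  obtain f where f: "covers (f ` {..<chunks k d * b}) (edges_upto b) k (radius k d)"
    by (auto simp: chunks_def)
  have "f ` {..<chunks k d * b} = {f (j * b + i) | j i. j < chunks k d \<and> i < b}" (is "?A = ?B")
  proof
    show "?A \<subseteq> ?B"
    proof
      fix S assume "S \<in> ?A"
      then obtain n where n: "S = f n" "n < chunks k d * b" by auto
      have "n div b < chunks k d" "n mod b < b"
        using n(2) assms by (auto simp: less_mult_imp_div_less)
      moreover have "S = f (n div b * b + n mod b)" using n(1) by simp
      ultimately show "S \<in> ?B" by blast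
    qed
    show "?B \<subseteq> ?A"
    proof
      fix S assume "S \<in> ?B"
      then obtain j i where S: "S = f (j * b + i)" "j < chunks k d" "i < b" by blast
      then have "j * b + i < Suc j * b" by simp
      also have "\<dots> \<le> chunks k d * b" using S(2) by (intro mult_le_mono1) auto
      finally show "S \<in> ?A" using S(1) by auto
    qed
  qed
  then have "covers {f (j * b + i) | j i. j < chunks k d \<and> i < b} (edges_upto b) k (radius k d)"
    using f by simp
  then show ?thesis
    unfolding family_def
    by (rule someI[of "\<lambda>f. covers {f j i | j i. j < chunks k d \<and> i < b} (edges_upto b) k (radius k d)"])
qed

section \<open>The stages\<close>

text \<open>\<open>elect\<close>, \<open>reach\<close> and \<open>spread\<close> describe the three
  stages on the graph itself, free of states and encodings.\<close>

primrec elect :: "nat set set \<Rightarrow> nat \<Rightarrow> nat \<Rightarrow> nat \<Rightarrow> nat option" where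
  "elect E d 0 v = Some v"
| "elect E d (Suc j) v = merge_id d j (elect E d j v) (elect E d j ` neighbours E v)"

primrec reach :: "nat \<Rightarrow> nat set set \<Rightarrow> nat \<Rightarrow> nat \<Rightarrow> nat \<Rightarrow> nat \<Rightarrow> nat \<Rightarrow> nat \<Rightarrow> bool" where
  "reach k E d M 0 v = (\<lambda>j i. v = M)"
| "reach k E d M (Suc y) v = (\<lambda>j i. reach k E d M y v j i \<or>
     (j = y div radius k d \<and> i < bits M \<and>
      (\<exists>u\<in>neighbours E v. reach k E d M y u j i \<and> {u, v} \<in> family k d (bits M) j i)))"

primrec spread :: "nat set set \<Rightarrow> (nat \<Rightarrow> 'a option) \<Rightarrow> nat \<Rightarrow> nat \<Rightarrow> 'a option" where
  "spread E w 0 v = w v"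
| "spread E w (Suc z) v = merge_cut (neighbours E v) (spread E w z v) (spread E w z)"

text \<open>The ball of radius \<open>Suc j\<close> around \<open>v\<close> is the union of the
  balls of radius \<open>j\<close> around \<open>v\<close> and its neighbours.\<close>

lemma elect_max:
  assumes "simple_graph V E" "j \<le> d"
  shows "\<exists>m. elect E d j v = Some m \<and> reaches E j m v \<and> (\<forall>u. reaches E j u v \<longrightarrow> u \<le> m)"
  using assms(2)
proof (induction j arbitrary: v)
  case (Suc j)
  then have "\<forall>v. \<exists>m. elect E d j v = Some m \<and> reaches E j m v \<and> (\<forall>u. reaches E j u v \<longrightarrow> u \<le> m)"
    by simp
  then obtain f where f: "\<And>v. elect E d j v = Some (f v)" "\<And>v. reaches E j (f v) v"
    "\<And>u v. reaches E j u v \<Longrightarrow> u \<le> f v"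
    by metis
  let ?S = "insert (f v) (f ` neighbours E v)"
  have "the ` insert (elect E d j v) (elect E d j ` neighbours E v) = ?S"
    by (simp add: f(1) image_image)
  then have eq: "elect E d (Suc j) v = Some (Max ?S)"
    using Suc.prems by (simp add: merge_id_def)
  have fin: "finite ?S" using finite_neighbours[OF assms(1)] by simp
  have step: "reaches E (Suc j) u v \<longleftrightarrow> (\<exists>w\<in>insert v (neighbours E v). reaches E j u w)" for u
    by (auto simp: adj_sym)
  have "reaches E (Suc j) x v" if "x \<in> ?S" for x
    using that f(2) unfolding step by auto
  then have "reaches E (Suc j) (Max ?S) v"
    using Max_in[OF fin] by blast
  moreover have "u \<le> Max ?S" if u: "reaches E (Suc j) u v" for u
  proof -
    obtain w where "w \<in> insert v (neighbours E v)" "u \<le> f w"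
      using u f(3) unfolding step by blast
    then show ?thesis using Max_ge[OF fin, of "f w"] by auto
  qed
  ultimately show ?case using eq by blast
qed simp

text \<open>Each check survived by \<open>v\<close> certifies agreement with all neighbours one
  round earlier, so \<open>i\<close> checks certify the ball of radius \<open>i\<close>.\<close>

lemma elect_agree:
  assumes "elect E d (d + i) v = Some m" "reaches E i u v"
  shows "elect E d d u = Some m"
  using assms
proof (induction i arbitrary: v)
  case (Suc i)
  have sub: "elect E d (d + i) ` neighbours E v \<subseteq> {elect E d (d + i) v}"
    and eq: "elect E d (d + i) v = Some m"
    using Suc.prems(1) by (auto simp: merge_id_def split: if_splits)
  have "elect E d (d + i) w = Some m" if "w = v \<or> w \<in> neighbours E v" for w
    using that subsetD[OF sub imageI] eq by fastforce
  then show ?case using Suc.IH Suc.prems(2) by (auto simp: adj_sym)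
qed simp

lemma elect_unanimous:
  assumes "simple_graph V E" "\<And>u. u \<in> V \<Longrightarrow> elect E d d u = Some m" "v \<in> V"
  shows "elect E d (d + i) v = Some m"
  using assms(3)
proof (induction i arbitrary: v)
  case (Suc i)
  have "u \<in> V" if "u \<in> neighbours E v" for u
    using reaches_vertex[OF assms(1), of 1 v u] Suc.prems that by (simp add: adj_sym)
  then show ?case using Suc by (auto simp: merge_id_def)
qed (simp add: assms(2))

text \<open>
  Chunk \<open>j\<close> is processed in rounds \<open>j * L, \<dots>, j * L + L - 1\<close> where \<open>L = radius k d\<close>; the
  truncated subtraction makes the distance \<open>0\<close> before that.
\<close>

lemma reach_iff:
  assumes "i < bits M"
  shows "reach k E d M y v j i \<longleftrightarrow>
    reaches (E \<inter> family k d (bits M) j i) (min (radius k d) (y - j * radius k d)) M v"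
proof (induction y arbitrary: v)
  case 0
  show ?case by auto
next
  case (Suc y)
  let ?L = "radius k d" and ?E = "E \<inter> family k d (bits M) j i"
  have L: "?L > 0" by (simp add: radius_def)
  show ?case
  proof (cases "j = y div ?L")
    case True
    then have "j * ?L \<le> y" "y < j * ?L + ?L"
      using L by (auto simp: dividend_less_div_times add.commute)
    then have "Suc y - j * ?L = Suc (y - j * ?L)" "y - j * ?L < ?L"
      by (auto simp: Suc_diff_le)
    then have "min ?L (Suc y - j * ?L) = Suc (min ?L (y - j * ?L))" by simp
    moreover have "(\<exists>u\<in>neighbours E v. reaches ?E n M u \<and> {u, v} \<in> family k d (bits M) j i)
        \<longleftrightarrow> (\<exists>u. reaches ?E n M u \<and> adj ?E u v)" for n
      by (auto simp: adj_def neighbours_def insert_commute)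
    moreover have "reach k E d M (Suc y) v j i \<longleftrightarrow> reach k E d M y v j i \<or>
        (\<exists>u\<in>neighbours E v. reach k E d M y u j i \<and> {u, v} \<in> family k d (bits M) j i)"
      using True assms by simp
    ultimately show ?thesis
      by (simp only: Suc reaches.simps(2))
  next
    case False
    have "min ?L (Suc y - j * ?L) = min ?L (y - j * ?L)"
    \<comment> \<open>Chunk \<open>j\<close> is either finished, with both minima equal to
      \<open>?L\<close>, or not yet begun, with both equal to \<open>0\<close>.\<close>
    proof (cases "j < y div ?L")
      case True
      then have "Suc j * ?L \<le> y div ?L * ?L" by (intro mult_le_mono1) simp
      also have "\<dots> \<le> y" by simp
      finally show ?thesis by simp
    next
      case False
      then have "y div ?L < j" using \<open>j \<noteq> y div ?L\<close> by simp
      then have "y < j * ?L" using L by (simp add: div_less_iff_less_mult)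
      then show ?thesis by simp
    qed
    then show ?thesis using False by (simp add: Suc)
  qed
qed

lemma merge_cut_eq_None:
  "merge_cut N w W = None \<longleftrightarrow> w = None \<and> (\<forall>u\<in>N. W u = None)"
proof (cases "w = None \<and> (\<exists>u\<in>N. W u \<noteq> None)")
  case True
  then have "\<exists>u. u \<in> N \<and> W u \<noteq> None" by blast
  from someI_ex[OF this] True show ?thesis
    by (auto simp: merge_cut_def)
next
  case False
  then show ?thesis by (cases w) (auto simp: merge_cut_def)
qed

lemma merge_cut_eq_Some:
  assumes "merge_cut N w W = Some F"
  shows "w = Some F \<or> (\<exists>u\<in>N. W u = Some F)"
proof (cases "w = None \<and> (\<exists>u\<in>N. W u \<noteq> None)")
  case True
  then have "\<exists>u. u \<in> N \<and> W u \<noteq> None" by blast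
  from someI_ex[OF this] True assms show ?thesis
    by (auto simp: merge_cut_def)
next
  case False
  then show ?thesis using assms by (cases w) (auto simp: merge_cut_def)
qed

text \<open>Decoded messages match the values of neighbours only, and the choice made by
  \<open>SOME\<close> looks only at these.\<close>

lemma merge_cut_cong:
  assumes "\<And>u. u \<in> N \<Longrightarrow> W u = W' u"
  shows "merge_cut N w W = merge_cut N w W'"
proof -
  have "(\<lambda>u. u \<in> N \<and> W u \<noteq> None) = (\<lambda>u. u \<in> N \<and> W' u \<noteq> None)"
    using assms by auto
  moreover have "W (SOME u. u \<in> N \<and> W' u \<noteq> None) = W' (SOME u. u \<in> N \<and> W' u \<noteq> None)"
    if "\<exists>u\<in>N. W' u \<noteq> None"
    using assms someI_ex[of "\<lambda>u. u \<in> N \<and> W' u \<noteq> None"] that by blast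
  ultimately show ?thesis
    using assms by (auto simp: merge_cut_def split: option.split)
qed

text \<open>Vertices may adopt different cuts; each is traced back to a vertex that found
  it.\<close>

lemma spread_origin:
  assumes "spread E w z v = Some F"
  shows "\<exists>u. reaches E z u v \<and> w u = Some F"
  using assms
proof (induction z arbitrary: v)
  case (Suc z)
  then obtain x where "x = v \<or> adj E x v" "spread E w z x = Some F"
    using merge_cut_eq_Some by (fastforce simp: adj_sym)
  then show ?case using Suc.IH by fastforce
qed simp

lemma spread_reaches:
  assumes "reaches E z u v" "w u \<noteq> None"
  shows "spread E w z v \<noteq> None"
  using assms(1)
proof (induction z arbitrary: v)
  case (Suc z)
  then obtain x where "x = v \<or> adj E x v" "reaches E z u x" by auto
  then have "x = v \<or> adj E x v" "spread E w z x \<noteq> None" using Suc.IH by blast+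
  then show ?case by (auto simp: merge_cut_eq_None adj_sym)
qed (use assms in simp)

section \<open>Executions\<close>

primrec phase_start :: "nat \<Rightarrow> nat" where
  "phase_start 0 = 0"
| "phase_start (Suc d) = phase_start d + (3 * d + 1)"

lemma phase_start_le: "phase_start d \<le> d * (3 * d + 1)"
proof (induction d)
  case (Suc d)
  have "d * (3 * d + 1) + (3 * d + 1) = Suc d * (3 * d + 1)" by simp
  also have "\<dots> \<le> Suc d * (3 * Suc d + 1)" by (intro mult_le_mono2) simp
  finally show ?case using Suc by simp
qed simp

lemma phase_start_split: "t < phase_start n \<Longrightarrow> \<exists>d<n. \<exists>j\<le>3 * d. t = phase_start d + j"
proof (induction n)
  case (Suc n)
  show ?case
  proof (cases "t < phase_start n")
    case True
    then show ?thesis using Suc.IH less_Suc_eq by blast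
  next
    case False
    then have "t = phase_start n + (t - phase_start n)" "t - phase_start n \<le> 3 * n"
      using Suc.prems by auto
    then show ?thesis by blast
  qed
qed simp

lemma chunks_radius_pos: "chunks k d * radius k d > 0"
  by (simp add: chunks_def radius_def)

text \<open>The edge connectivity is left open here, since the bandwidth bound concerns all
  networks.\<close>

locale execution =
  fixes k a :: nat and V :: "nat set" and E :: "nat set set"
  assumes network: "network a V E"
begin

lemma simple: "simple_graph V E" and finite_V: "finite V" and card_V: "card V \<ge> 2"
  using network by (auto simp: network_def simple_graph_def)

lemma neighbour_vertex: "v \<in> V \<Longrightarrow> adj E v u \<Longrightarrow> u \<in> V"
  using reaches_vertex[OF simple, of 1 v u] by simp

definition leader :: nat where
  "leader = Max V"

lemma leader_vertex: "leader \<in> V" and le_leader: "v \<in> V \<Longrightarrow> v \<le> leader"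
proof -
  have "V \<noteq> {}" using card_V by auto
  then show "leader \<in> V" using finite_V by (simp add: leader_def)
  show "v \<in> V \<Longrightarrow> v \<le> leader" using finite_V by (simp add: leader_def)
qed

text \<open>Two distinct identifiers force a positive maximum. This provides the hypothesis of
  \<open>covers_family\<close>.\<close>

lemma bits_leader: "bits leader \<ge> 1"
proof -
  have "leader \<noteq> 0"
  proof
    assume "leader = 0"
    then have "V \<subseteq> {0}" using le_leader by force
    then show False using card_V card_mono[of "{0}" V] by simp
  qed
  then show ?thesis by (simp add: bits_def floorlog_def)
qed

definition good_guess :: "nat \<Rightarrow> bool" where
  "good_guess d \<longleftrightarrow> (\<forall>v\<in>V. reaches E d leader v)"

text \<open>The eccentricity of \<open>leader\<close>; the election first succeeds at this
  guess.\<close>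

definition guess :: nat where
  "guess = (LEAST d. good_guess d)"

lemma good_guess_diameter: "good_guess (diameter V E)"
  using reaches_diameter[OF network leader_vertex] by (simp add: good_guess_def)

lemma guess_good: "good_guess guess" and guess_le: "guess \<le> diameter V E"
  and not_good: "d < guess \<Longrightarrow> \<not> good_guess d"
  unfolding guess_def using good_guess_diameter by (auto intro: LeastI Least_le dest: not_less_Least)

text \<open>Bounds the identifiers sent. A value that survives checking equals the one at the end of
  flooding, which comes from a vertex in the \<open>d\<close>-ball.\<close>

lemma elect_vertex:
  assumes "v \<in> V" "elect E d j v = Some m"
  shows "m \<in> V"
proof (cases "j \<le> d")
  case True
  then have "reaches E j m v" using elect_max[OF simple True, of v] assms by auto
  then show ?thesis using reaches_vertex[OF simple reaches_sym] assms by blast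
next
  case False
  then have "elect E d d v = Some m"
    using elect_agree[of E d "j - d" v m v] assms reaches_refl by simp
  then have "reaches E d m v" using elect_max[OF simple, of d d v] by auto
  then show ?thesis using reaches_vertex[OF simple reaches_sym] assms by blast
qed

text \<open>
  If \<open>v\<close> sees no conflict, then the ball of radius \<open>2 * d + 1\<close> around \<open>v\<close> agrees on some \<open>m\<close>, so it
  lies within distance \<open>d\<close> of \<open>m\<close>, hence within distance \<open>2 * d\<close> of \<open>v\<close>, and it is the whole graph.
\<close>

lemma elect_sound:
  assumes "v \<in> V" and elect: "elect E d (Suc (3 * d)) v = Some m"
  shows "good_guess d"
proof -
  have agree: "elect E d d u = Some m" if "reaches E (2 * d + 1) u v" for u
    using elect_agree[of E d "2 * d + 1"] that elect by simp
  have near: "reaches E d m u" if "reaches E (2 * d + 1) u v" for u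
    using agree[OF that] elect_max[OF simple, of d d u] by auto
  have "reaches E (2 * d) v u" if "u \<in> V" for u
  proof (rule reaches_stable)
    show "(adj E)\<^sup>*\<^sup>* v u"
      using network assms that by (simp add: network_def graph_connected_def)
    fix w assume "reaches E (Suc (2 * d)) v w"
    then have "reaches E d m w" "reaches E d m v"
      using near[OF reaches_sym] near[OF reaches_refl] by auto
    then show "reaches E (2 * d) v w"
      using reaches_trans[OF reaches_sym] by (metis mult_2)
  qed
  then have all: "reaches E (2 * d + 1) u v" if "u \<in> V" for u
    using that reaches_sym by auto
  \<comment> \<open>The leader lies in the agreeing ball too, and its value is at least its own
    identifier.\<close>
  have "m = leader"
  proof (rule antisym)
    show "m \<le> leader" using elect_vertex[OF assms] le_leader by blast
    show "leader \<le> m"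
      using agree[OF all[OF leader_vertex]] elect_max[OF simple, of d d leader] reaches_refl by auto
  qed
  then show ?thesis using near all by (simp add: good_guess_def)
qed

text \<open>After \<open>d\<close> rounds every vertex has seen the leader, so all values coincide
  and no check can fail.\<close>

lemma elect_complete:
  assumes "good_guess d" "v \<in> V"
  shows "elect E d (Suc (3 * d)) v = Some leader"
proof -
  have "elect E d d u = Some leader" if "u \<in> V" for u
  proof -
    obtain m where "elect E d d u = Some m" "\<And>x. reaches E d x u \<Longrightarrow> x \<le> m"
      using elect_max[OF simple, of d d u] by auto
    moreover from this have "m = leader"
      using elect_vertex[OF that] assms(1) that le_leader by (auto simp: good_guess_def intro: antisym)
    ultimately show ?thesis by simp
  qed
  from elect_unanimous[OF simple this assms(2), of "2 * d + 1"] show ?thesis by simp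
qed

section \<open>The election in an execution\<close>

lemma run_Elect_step:
  assumes "\<And>v. v \<in> V \<Longrightarrow> run k E t v = Elect d j (elect E d j v)" "v \<in> V"
  shows "run k E (Suc t) v = (if j = 3 * d
    then (case elect E d (Suc j) v of None \<Rightarrow> Elect (Suc d) 0 (Some v) | Some M \<Rightarrow> Reach d M 0 (\<lambda>j i. v = M))
    else Elect d (Suc j) (elect E d (Suc j) v))"
proof -
  have "(\<lambda>u. decode_id (if adj E u v then message k (run k E t u) u v else [])) ` neighbours E v
      = elect E d j ` neighbours E v"
    using assms neighbour_vertex[OF assms(2)] by (intro image_cong) (auto simp: adj_sym)
  then show ?thesis using assms by (simp add: Let_def)
qed

text \<open>By \<open>elect_sound\<close>, every guess below \<open>guess\<close> fails at all
  vertices simultaneously, which keeps them in step.\<close>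

lemma run_Elect:
  assumes "d \<le> guess" "j \<le> 3 * d" "v \<in> V"
  shows "run k E (phase_start d + j) v = Elect d j (elect E d j v)"
  using assms
proof (induction d arbitrary: j v)
  case 0
  then show ?case by simp
next
  case (Suc d)
  have start: "run k E (phase_start (Suc d)) v = Elect (Suc d) 0 (Some v)" if "v \<in> V" for v
  proof -
    have "elect E d (Suc (3 * d)) v = None"
      using elect_sound[OF that] not_good[of d] Suc.prems(1) by fastforce
    then show ?thesis
      using run_Elect_step[of "phase_start d + 3 * d" d "3 * d" v] Suc.IH Suc.prems(1) that by simp
  qed
  show ?case using Suc.prems(2,3)
  proof (induction j arbitrary: v)
    case 0
    then show ?case using start by simp
  next
    case (Suc j)
    then show ?case
      using run_Elect_step[of "phase_start (Suc d) + j" "Suc d" j v] by simp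
  qed
qed

section \<open>Flooding the covering family\<close>

definition reach_start :: nat where
  "reach_start = phase_start (Suc guess)"

definition spread_start :: nat where
  "spread_start = reach_start + chunks k guess * radius k guess"

definition found :: "nat \<Rightarrow> nat set set option" where
  "found v = choose_candidate k guess (bits leader)
     (reach k E guess leader (chunks k guess * radius k guess) v)"

lemma run_Reach_step:
  assumes "\<And>v. v \<in> V \<Longrightarrow> run k E t v = Reach d M y (reach k E d M y v)" "v \<in> V"
  shows "run k E (Suc t) v = (if Suc y = chunks k d * radius k d
    then Spread d M 0 (choose_candidate k d (bits M) (reach k E d M (Suc y) v))
    else Reach d M (Suc y) (reach k E d M (Suc y) v))"
proof -
  let ?I = "\<lambda>u. if adj E u v then message k (run k E t u) u v else []"
  \<comment> \<open>The bound on \<open>i\<close> is the message length, beyond which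
    \<open>!\<close> is unspecified; \<open>step\<close> carries the same guard.\<close>
  have "?I u ! i \<longleftrightarrow> reach k E d M y u (y div radius k d) i \<and> {u, v} \<in> family k d (bits M) (y div radius k d) i"
    if "u \<in> neighbours E v" "i < bits M" for u i
    using that assms neighbour_vertex[OF assms(2)] by (simp add: adj_sym)
  then have iff: "(\<exists>u\<in>neighbours E v. ?I u ! i) \<longleftrightarrow> (\<exists>u\<in>neighbours E v.
      reach k E d M y u (y div radius k d) i \<and> {u, v} \<in> family k d (bits M) (y div radius k d) i)"
    if "i < bits M" for i
    using that by blast
  have "(\<lambda>j i. reach k E d M y v j i \<or>
      (j = y div radius k d \<and> i < bits M \<and> (\<exists>u\<in>neighbours E v. ?I u ! i))) = reach k E d M (Suc y) v"
    unfolding reach.simps using iff by (intro ext) blast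
  then show ?thesis using assms by (simp only: run.simps step.simps Let_def)
qed

lemma run_Reach:
  assumes "y < chunks k guess * radius k guess" "v \<in> V"
  shows "run k E (reach_start + y) v = Reach guess leader y (reach k E guess leader y v)"
  using assms
proof (induction y arbitrary: v)
  case 0
  have "run k E (Suc (phase_start guess + 3 * guess)) v = Reach guess leader 0 (\<lambda>j i. v = leader)"
    using run_Elect_step[OF run_Elect[OF le_refl le_refl]] elect_complete[OF guess_good] 0 by simp
  then show ?case by (simp add: reach_start_def)
next
  case (Suc y)
  then show ?case
    using run_Reach_step[of "reach_start + y" guess leader y v] by simp
qed

lemma run_Spread_start:
  assumes "v \<in> V"
  shows "run k E spread_start v = Spread guess leader 0 (found v)"
proof -
  obtain y where y: "Suc y = chunks k guess * radius k guess"
    using chunks_radius_pos[of k guess] gr0_conv_Suc by metis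
  have "run k E (Suc (reach_start + y)) v = Spread guess leader 0 (found v)"
    using run_Reach_step[of "reach_start + y" guess leader y v] run_Reach y assms
    by (simp add: found_def)
  then show ?thesis by (simp add: spread_start_def flip: y)
qed

section \<open>Broadcasting a cut\<close>

lemma candidates_cuts_upto: "candidates k d b R \<subseteq> cuts_upto k b"
  by (auto simp: candidates_def)

lemma choose_candidate_Some: "choose_candidate k d b R = Some F \<Longrightarrow> F \<in> candidates k d b R"
  by (auto simp: choose_candidate_def some_in_eq split: if_splits)

text \<open>Every cut in circulation is a candidate of some vertex. This makes it decodable here and
  a minimum cut later.\<close>

lemma spread_found:
  assumes "v \<in> V" "spread E found z v = Some F"
  obtains u where "u \<in> V"
    "F \<in> candidates k guess (bits leader) (reach k E guess leader (chunks k guess * radius k guess) u)"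
proof -
  obtain u where "reaches E z u v" "found u = Some F"
    using spread_origin[OF assms(2)] by blast
  then show ?thesis
    using that reaches_vertex[OF simple reaches_sym] assms(1) choose_candidate_Some
    unfolding found_def by blast
qed

lemma run_Spread_step:
  assumes IH: "\<And>v. v \<in> V \<Longrightarrow> run k E t v = Spread guess leader z (spread E found z v)" and "v \<in> V"
  shows "run k E (Suc t) v = (if z = 2 * guess then Halt (the (spread E found (Suc z) v))
    else Spread guess leader (Suc z) (spread E found (Suc z) v))"
proof -
  let ?I = "\<lambda>u. if adj E u v then message k (run k E t u) u v else []"
  let ?W = "\<lambda>u. if ?I u = [] then None else Some (decode_cut k (bits leader) (?I u))"
  have "?W u = spread E found z u" if "u \<in> neighbours E v" for u
  proof -
    have u: "adj E u v" "u \<in> V"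
      using that neighbour_vertex[OF \<open>v \<in> V\<close>] by (auto simp: adj_sym)
    show ?thesis
    proof (cases "spread E found z u")
      case (Some F)
      then have "F \<in> cuts_upto k (bits leader)"
        by (rule spread_found[OF u(2)]) (use candidates_cuts_upto in blast)
      then show ?thesis
        using u IH[OF u(2)] Some decode_encode_cut by simp
    qed (use u IH in simp)
  qed
  then have "merge_cut (neighbours E v) (spread E found z v) ?W = spread E found (Suc z) v"
    unfolding spread.simps by (rule merge_cut_cong)
  then show ?thesis using IH[OF \<open>v \<in> V\<close>] by (simp only: run.simps step.simps Let_def)
qed

lemma run_Spread:
  assumes "z \<le> 2 * guess" "v \<in> V"
  shows "run k E (spread_start + z) v = Spread guess leader z (spread E found z v)"
  using assms
proof (induction z arbitrary: v)
  case 0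
  then show ?case using run_Spread_start by simp
next
  case (Suc z)
  then show ?case
    using run_Spread_step[of "spread_start + z" z v] by simp
qed

definition halting_time :: nat where
  "halting_time = spread_start + (2 * guess + 1)"

lemma run_Halt_final:
  assumes "v \<in> V"
  shows "run k E halting_time v = Halt (the (spread E found (2 * guess + 1) v))"
  using run_Spread_step[OF run_Spread[OF le_refl] assms] by (simp add: halting_time_def)

section \<open>Correctness\<close>

text \<open>The universe of possible edges is computable from \<open>leader\<close> alone, without
  knowledge of \<open>E\<close>.\<close>

lemma edges_subset: "E \<subseteq> edges_upto (bits leader)"
proof
  fix e assume "e \<in> E"
  then have "e \<subseteq> V" "card e = 2" using simple by (auto simp: simple_graph_def)
  moreover have "v < 2 ^ bits leader" if "v \<in> V" for v
    using le_leader[OF that] less_two_power_bits[of leader] by linarith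
  ultimately show "e \<in> edges_upto (bits leader)" by (auto simp: edges_upto_def)
qed

lemma reach_final:
  assumes "i < bits leader" "j < chunks k guess"
  shows "reach k E guess leader (chunks k guess * radius k guess) v j i \<longleftrightarrow>
    reaches (E \<inter> family k guess (bits leader) j i) (radius k guess) leader v"
proof -
  have "Suc j * radius k guess \<le> chunks k guess * radius k guess"
    using assms(2) by (intro mult_le_mono1) simp
  then have "min (radius k guess) (chunks k guess * radius k guess - j * radius k guess) = radius k guess"
    by simp
  then show ?thesis using reach_iff[OF assms(1)] by simp
qed

lemma graph_connected_iff: "graph_connected V E' \<longleftrightarrow> (\<forall>v\<in>V. (adj E')\<^sup>*\<^sup>* leader v)"
  unfolding graph_connected_def
  using leader_vertex rtranclp_adj_sym by (meson rtranclp_trans)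

text \<open>Otherwise a short path \<open>P\<close> avoids \<open>F\<close>, and a member containing
  \<open>P\<close> and missing \<open>F\<close> reaches \<open>v\<close>, which rules
  \<open>F\<close> out as a candidate.\<close>

lemma candidate_separates:
  assumes "v \<in> V"
    and F: "F \<in> candidates k guess (bits leader) (reach k E guess leader (chunks k guess * radius k guess) v)"
  shows "\<not> (adj (E - F))\<^sup>*\<^sup>* leader v"
proof
  let ?U = "edges_upto (bits leader)" and ?L = "radius k guess"
  assume "(adj (E - F))\<^sup>*\<^sup>* leader v"
  moreover have F': "F \<subseteq> ?U" "card F = k" "finite F"
    using F finite_edges_upto finite_subset by (auto simp: candidates_def cuts_upto_def)
  moreover have "card e = 2" if "e \<in> F" for e
    using that F' by (auto simp: edges_upto_def)
  ultimately have "reaches (E - F) ?L leader v"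
    unfolding radius_def using guess_good leader_vertex
    by (intro reaches_after_deletion[OF simple]) (auto simp: good_guess_def)
  then obtain P where P: "P \<subseteq> E - F" "card P \<le> ?L" "reaches P ?L leader v"
    using reaches_path by metis
  have "F \<subseteq> ?U \<and> P \<subseteq> ?U \<and> F \<inter> P = {} \<and> card F \<le> k \<and> card P \<le> ?L"
    using F' P edges_subset by auto
  then obtain S where S: "S \<in> {family k guess (bits leader) j i | j i. j < chunks k guess \<and> i < bits leader}"
    "F \<inter> S = {}" "P \<subseteq> S"
    using covers_family[OF bits_leader, of k guess] unfolding covers_def by meson
  then obtain j i where ji: "j < chunks k guess" "i < bits leader" "S = family k guess (bits leader) j i"
    by blast
  have "reaches (E \<inter> S) ?L leader v"
    using P(3) by (rule reaches_mono_edges) (use P S in auto)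
  then have "reach k E guess leader (chunks k guess * radius k guess) v j i"
    using ji by (simp add: reach_final)
  then show False using F S ji by (auto simp: candidates_def)
qed

text \<open>A vertex cannot test whether \<open>F\<close> consists of edges of the graph. But
  \<open>F \<inter> E\<close> is already a cut, so by minimality it has \<open>k\<close> elements
  and equals \<open>F\<close>.\<close>

lemma candidate_minimum_cut:
  assumes conn: "edge_connectivity V E = k" and "v \<in> V"
    and F: "F \<in> candidates k guess (bits leader) (reach k E guess leader (chunks k guess * radius k guess) v)"
  shows "minimum_cut V E F"
proof -
  have fin: "finite F" "card F = k"
    using F finite_edges_upto finite_subset by (auto simp: candidates_def cuts_upto_def)
  have "E - F \<inter> E = E - F" by auto
  then have cut: "edge_cut V E (F \<inter> E)"
    using candidate_separates[OF assms(2,3)] \<open>v \<in> V\<close> by (auto simp: edge_cut_def graph_connected_iff)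
  then have "edge_connectivity V E \<le> card (F \<inter> E)"
    unfolding edge_connectivity_def by (intro Least_le) blast
  then have "F \<inter> E = F"
    using conn fin by (intro card_seteq) auto
  then show ?thesis using cut fin conn by (simp add: minimum_cut_def)
qed

text \<open>A minimum cut separates some \<open>v\<close> from the leader, and no member missing the
  cut can reach this \<open>v\<close>.\<close>

lemma exists_candidate:
  assumes conn: "edge_connectivity V E = k"
  shows "\<exists>v\<in>V. found v \<noteq> None"
proof -
  \<comment> \<open>So \<open>E\<close> itself is a cut, and the \<open>LEAST\<close> in
    \<open>edge_connectivity\<close> is attained.\<close>
  have "\<not> graph_connected V {}"
  proof
    assume "graph_connected V {}"
    moreover have "v = leader" if "(adj {})\<^sup>*\<^sup>* leader v" for v
      using that by induction (auto simp: adj_def)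
    ultimately have "V \<subseteq> {leader}" by (auto simp: graph_connected_iff)
    then show False using card_V card_mono[of "{leader}" V] by simp
  qed
  then have "\<exists>n C. edge_cut V E C \<and> card C = n"
    by (auto simp: edge_cut_def intro!: exI[of _ E])
  from LeastI_ex[OF this] obtain C where C: "edge_cut V E C" "card C = k"
    using conn by (auto simp: edge_connectivity_def)
  then obtain v where v: "v \<in> V" "\<not> (adj (E - C))\<^sup>*\<^sup>* leader v"
    by (auto simp: edge_cut_def graph_connected_iff)
  have "C \<in> candidates k guess (bits leader) (reach k E guess leader (chunks k guess * radius k guess) v)"
    unfolding candidates_def
  proof (intro CollectI conjI allI impI)
    show "C \<in> cuts_upto k (bits leader)"
      using C edges_subset by (auto simp: cuts_upto_def edge_cut_def)
    fix j i
    assume ji: "j < chunks k guess" "i < bits leader" and "C \<inter> family k guess (bits leader) j i = {}"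
    then have "E \<inter> family k guess (bits leader) j i \<subseteq> E - C" by auto
    then have "\<not> reaches (E \<inter> family k guess (bits leader) j i) (radius k guess) leader v"
      using v(2) reaches_mono_edges reaches_imp_rtranclp by blast
    then show "\<not> reach k E guess leader (chunks k guess * radius k guess) v j i"
      using ji by (simp add: reach_final)
  qed
  then show ?thesis using v(1) by (auto simp: found_def choose_candidate_def)
qed

lemma outputs_minimum_cut:
  assumes "edge_connectivity V E = k" "v \<in> V"
  shows "\<exists>C. outputs_within halting_time (cut_algorithm k) E v C \<and> minimum_cut V E C"
proof -
  obtain u where u: "u \<in> V" "found u \<noteq> None"
    using exists_candidate[OF assms(1)] by blast
  \<comment> \<open>The cut travels at most as far as the route from \<open>u\<close> to
    \<open>v\<close> through the leader.\<close>
  have "reaches E (guess + guess) u v"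
    using reaches_trans[OF reaches_sym[of E guess leader u], of guess v] guess_good u(1) assms(2)
    by (simp add: good_guess_def)
  then have "reaches E (2 * guess + 1) u v"
    by (rule reaches_mono) simp
  then obtain F where F: "spread E found (2 * guess + 1) v = Some F"
    using spread_reaches[of E _ u v found] u(2) by blast
  have "minimum_cut V E F"
    using spread_found[OF assms(2) F] candidate_minimum_cut[OF assms(1)] by blast
  moreover have "outputs_within halting_time (cut_algorithm k) E v F"
    using run_Halt_final[OF assms(2)] F by (intro outputs_withinI) simp
  ultimately show ?thesis by blast
qed

section \<open>Complexity\<close>

text \<open>An identifier below \<open>card V ^ a\<close> has at most
  \<open>a * log 2 (card V) + 1\<close> bits, and the \<open>1\<close> is absorbed since
  \<open>card V \<ge> 2\<close>.\<close>

lemma bits_le: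
  assumes "v \<in> V"
  shows "real (bits v) \<le> real (a + 1) * log 2 (real (card V))"
proof (cases "v = 0")
  case True
  then show ?thesis using card_V by (simp add: bits_def floorlog_def)
next
  case False
  have lt: "v < card V ^ a" using network assms by (auto simp: network_def)
  have log1: "log 2 (real (card V)) \<ge> 1" using card_V by simp
  have "log 2 (real v) \<le> log 2 (real (card V ^ a))"
    using False lt card_V by simp
  also have "\<dots> = real a * log 2 (real (card V))"
    using card_V by (simp add: log_nat_power)
  finally have "log 2 (real v) \<le> real a * log 2 (real (card V))" .
  moreover have "real (bits v) \<le> log 2 (real v) + 1"
    using False by (simp add: bits_def floorlog_def)
  ultimately show ?thesis using log1 by (simp add: algebra_simps)
qed

text \<open>The witness is the vertex whose identifier sets the size: the one being sent during the
  election, \<open>leader\<close> afterwards. The longest messages are encoded cuts.\<close>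

lemma message_length:
  assumes "v \<in> V"
  shows "\<exists>w\<in>V. length (message k (run k E t v) v u) \<le> (2 * k + 1) * bits w + 1"
proof -
  consider (elect) "t < reach_start" | (reach) y where "t = reach_start + y" "y < chunks k guess * radius k guess"
    | (spread) z where "t = spread_start + z" "z \<le> 2 * guess" | (halt) z where "t = halting_time + z"
  proof -
    have "t < reach_start \<or> (\<exists>y. t = reach_start + y \<and> y < chunks k guess * radius k guess)
      \<or> (\<exists>z. t = spread_start + z \<and> z \<le> 2 * guess) \<or> (\<exists>z. t = halting_time + z)"
      unfolding spread_start_def halting_time_def by presburger
    then show ?thesis using that by blast
  qed
  then show ?thesis
  proof cases
    case elect
    then obtain d j where dj: "d < Suc guess" "j \<le> 3 * d" "t = phase_start d + j"
      using phase_start_split[of t "Suc guess"] unfolding reach_start_def by blast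
    then have run: "run k E t v = Elect d j (elect E d j v)"
      using run_Elect assms by simp
    show ?thesis
    proof (cases "elect E d j v")
      case None
      then show ?thesis using run assms by (auto simp: encode_id_def)
    next
      case (Some m)
      then show ?thesis
        using run elect_vertex[OF assms Some] by (auto simp: encode_id_def intro!: bexI[of _ m])
    qed
  next
    case reach
    then show ?thesis
      using run_Reach assms leader_vertex by (auto intro!: bexI[of _ leader])
  next
    case spread
    then have "message k (run k E t v) v u = encode_cut k (bits leader) (spread E found z v)"
      using run_Spread assms by simp
    moreover have "length (encode_cut k (bits leader) w) \<le> (2 * k + 1) * bits leader + 1" for w
      using cut_code_spec[of k "bits leader"] by (auto simp: encode_cut_def split: option.split)
    ultimately show ?thesis using leader_vertex by metis
  next
    case halt
    then show ?thesis using run_Halt[OF run_Halt_final[OF assms]] assms by auto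
  qed
qed

lemma message_length_log:
  assumes "v \<in> V"
  shows "real (length (message k (run k E t v) v u))
    \<le> real ((2 * k + 1) * (a + 1) + 1) * log 2 (real (card V))"
proof -
  obtain w where w: "w \<in> V" "length (message k (run k E t v) v u) \<le> (2 * k + 1) * bits w + 1"
    using message_length[OF assms] by blast
  have "real (length (message k (run k E t v) v u)) \<le> real ((2 * k + 1) * bits w + 1)"
    using w(2) by (simp only: of_nat_le_iff)
  also have "\<dots> = real (2 * k + 1) * real (bits w) + 1"
    by (simp only: of_nat_add of_nat_mult of_nat_1)
  also have "\<dots> \<le> real (2 * k + 1) * (real (a + 1) * log 2 (real (card V))) + log 2 (real (card V))"
    using bits_le[OF w(1)] card_V by (intro add_mono mult_left_mono) auto
  also have "\<dots> = real ((2 * k + 1) * (a + 1) + 1) * log 2 (real (card V))"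
    by (simp only: of_nat_add of_nat_mult of_nat_1) (simp only: algebra_simps mult_1_left)
  finally show ?thesis .
qed

end

section \<open>The polynomial bound on the number of rounds\<close>

definition radius_poly :: "nat \<Rightarrow> nat poly" where
  "radius_poly k = [:2 * k + 1:] * [:1, 2:]"

text \<open>The summands bound election, flooding and broadcast; the degree is
  \<open>k + 2\<close>.\<close>

definition round_poly :: "nat \<Rightarrow> nat poly" where
  "round_poly k = [:1, 1:] * [:4, 3:]
     + [:3:] * ([:2:] * ([:2:] * radius_poly k) ^ k) * ([:k:] + radius_poly k) * radius_poly k + [:1, 2:]"

lemma poly_round_poly:
  "poly (round_poly k) d = Suc d * (3 * Suc d + 1) + chunks k d * radius k d + (2 * d + 1)"
proof -
  have "poly (radius_poly k) d = radius k d"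
    by (simp add: radius_poly_def radius_def algebra_simps)
  then show ?thesis
    by (simp add: round_poly_def chunks_def algebra_simps)
qed

text \<open>Natural coefficients make the bound monotone, so \<open>guess\<close> may be replaced by
  the diameter.\<close>

lemma poly_nat_mono:
  fixes p :: "nat poly"
  assumes "x \<le> y"
  shows "poly p x \<le> poly p y"
  using assms by (induction p) (auto intro!: add_mono mult_le_mono)

lemma (in execution) halting_time_le: "halting_time \<le> poly (round_poly k) (diameter V E)"
proof -
  have "halting_time \<le> poly (round_poly k) guess"
    using phase_start_le[of "Suc guess"]
    by (simp add: poly_round_poly halting_time_def spread_start_def reach_start_def)
  also have "\<dots> \<le> poly (round_poly k) (diameter V E)"
    by (rule poly_nat_mono) (rule guess_le)
  finally show ?thesis .
qed

lemma outputs_within_mono: "outputs_within S A E v x \<Longrightarrow> S \<le> T \<Longrightarrow> outputs_within T A E v x"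
  unfolding outputs_within_def by (meson le_trans)

theorem theorem2:
  shows "\<forall>k::nat. \<exists>(A :: nat set set algorithm) (p :: nat poly). \<forall>a.
    congest a A \<and>
    (\<forall>V E. network a V E \<and> edge_connectivity V E = k \<longrightarrow>
       (\<forall>v\<in>V. \<exists>C. outputs_within (poly p (diameter V E)) A E v C \<and> minimum_cut V E C))"
proof (rule allI)
  fix k :: nat
  show "\<exists>(A :: nat set set algorithm) (p :: nat poly). \<forall>a. congest a A \<and>
    (\<forall>V E. network a V E \<and> edge_connectivity V E = k \<longrightarrow>
       (\<forall>v\<in>V. \<exists>C. outputs_within (poly p (diameter V E)) A E v C \<and> minimum_cut V E C))"
  proof (intro exI[of _ "cut_algorithm k"] exI[of _ "round_poly k"] allI conjI impI ballI)
    fix a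
    show "congest a (cut_algorithm k)"
    proof (rule congestI)
      fix V E t u v assume "network a V E" "u \<in> V" "v \<in> V"
      then interpret execution k a V E by unfold_locales
      show "real (length (message k (run k E t u) u v))
          \<le> real ((2 * k + 1) * (a + 1) + 1) * log 2 (real (card V))"
        using \<open>u \<in> V\<close> by (rule message_length_log)
    qed simp
    fix V E v assume "network a V E \<and> edge_connectivity V E = k" and "v \<in> V"
    then interpret execution k a V E by unfold_locales simp
    obtain C where "outputs_within halting_time (cut_algorithm k) E v C" "minimum_cut V E C"
      using outputs_minimum_cut[of v] \<open>network a V E \<and> edge_connectivity V E = k\<close> \<open>v \<in> V\<close> by blast
    then show "\<exists>C. outputs_within (poly (round_poly k) (diameter V E)) (cut_algorithm k) E v C
        \<and> minimum_cut V E C"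
      by (blast intro: outputs_within_mono halting_time_le)
  qed
qed

end
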